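(* For every integer $m\ge 2$ there exists a nearly neighborly centrally symmetric simplicial $3$-sphere with $4m$ vertices that has a (vertex-)transitive cyclic group action on its $4m$ vertices.
   Context: A simplicial $3$-sphere is a finite simplicial complex whose geometric realization is homeomorphic to $S^3$. A simplicial manifold is centrally symmetric if it is invariant under an involution $I$ of its vertex set that fixes no (non-empty) face. A centrally symmetric simplicial $3$-sphere is nearly neighborly if it is centrally $2$-neighborly, i.e. if every pair of distinct vertices $\{v,w\}$ with $w\neq I(v)$ is an edge of it (equivalently, if it has $2k$ vertices and contains the $1$-skeleton of the boundary of the $k$-dimensional crosspolytope). A simplicial complex with $n$ vertices has a transitive cyclic group action if, after labeling its vertices by $1,\dots,n$, the $n$-cycle $(1\,2\,\cdots\,n)$ is an automorphism of the complex. *)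

theory Defs
  imports "HOL-Analysis.Analysis" "HOL-Combinatorics.Cycles"
begin

text \<open>Abstract simplicial complexes are given by their set of faces, the empty face included;
  the vertex set is the union of all faces.\<close>

definition finite_simplicial_complex :: "'a set set \<Rightarrow> bool" where
  "finite_simplicial_complex K \<longleftrightarrow>
     finite K \<and> (\<forall>s\<in>K. finite s) \<and> (\<forall>s\<in>K. \<forall>t. t \<subseteq> s \<longrightarrow> t \<in> K)"

definition vertices :: "'a set set \<Rightarrow> 'a set" where
  "vertices K = \<Union>K"

text \<open>Points are given by their barycentric coordinates: nonnegative weights on the vertices with
  total 1 whose support is a face. For a finite complex all coordinates outside the finite vertex
  set vanish, so the product topology induces the usual Euclidean one.\<close>

definition geometric_realization :: "'a set set \<Rightarrow> ('a \<Rightarrow> real) topology" where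
  "geometric_realization K =
     subtopology (powertop_real UNIV)
       {x. (\<forall>v. 0 \<le> x v) \<and> {v. x v \<noteq> 0} \<in> K \<and> (\<Sum>v | x v \<noteq> 0. x v) = 1}"

definition simplicial_3_sphere :: "'a set set \<Rightarrow> bool" where
  "simplicial_3_sphere K \<longleftrightarrow>
     finite_simplicial_complex K \<and> geometric_realization K homeomorphic_space nsphere 3"

definition simplicial_automorphism :: "'a set set \<Rightarrow> ('a \<Rightarrow> 'a) \<Rightarrow> bool" where
  "simplicial_automorphism K f \<longleftrightarrow>
     bij_betw f (vertices K) (vertices K) \<and> (\<lambda>s. f ` s) ` K = K"

definition central_symmetry :: "'a set set \<Rightarrow> ('a \<Rightarrow> 'a) \<Rightarrow> bool" where
  "central_symmetry K I \<longleftrightarrow>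
     simplicial_automorphism K I \<and> (\<forall>v\<in>vertices K. I (I v) = v) \<and>
     (\<forall>s\<in>K. s \<noteq> {} \<longrightarrow> I ` s \<noteq> s)"

definition centrally_2_neighborly :: "'a set set \<Rightarrow> ('a \<Rightarrow> 'a) \<Rightarrow> bool" where
  "centrally_2_neighborly K I \<longleftrightarrow>
     (\<forall>v\<in>vertices K. \<forall>w\<in>vertices K. v \<noteq> w \<and> w \<noteq> I v \<longrightarrow> {v, w} \<in> K)"

definition nearly_neighborly_cs_3_sphere :: "'a set set \<Rightarrow> bool" where
  "nearly_neighborly_cs_3_sphere K \<longleftrightarrow>
     simplicial_3_sphere K \<and> (\<exists>I. central_symmetry K I \<and> centrally_2_neighborly K I)"

definition has_transitive_cyclic_action :: "'a set set \<Rightarrow> bool" where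
  "has_transitive_cyclic_action K \<longleftrightarrow>
     (\<exists>l. bij_betw l (vertices K) {1..card (vertices K)} \<and>
          simplicial_automorphism ((\<lambda>s. l ` s) ` K) (cycle_of_list [1..<Suc (card (vertices K))]))"

end

theory Submission
  imports Defs
begin

text \<open>
  In \<open>\<int>/4m\<close> join the cycle through the even vertices (edges \<open>{i - 2, i}\<close>) with the cycle through the
  odd ones; the result is a 3-sphere. For every vertex \<open>i\<close>, of either parity, this sphere contains
  the ball \<open>{i - 2, i} * (i + 1, i + 3, \<dots>, i + 2m - 1)\<close>, the join of an edge of one cycle with a path of
  the other. These \<open>4m\<close> balls have no tetrahedron in common, and the tetrahedra outside all of them
  are the \<open>{i, i + 1, i + 2, i + 3}\<close>. Retriangulating each ball, by replacing the path with the chord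
  \<open>{i + 1, i + 2m - 1}\<close> and coning its two suspension points over the fan of triangles
  \<open>{i + 1, i + 1 + 2c, i + 3 + 2c}\<close>, adds exactly the missing edges between vertices of equal parity
  that are not antipodal, and the outcome is invariant under \<open>i \<mapsto> i + 1\<close>. The retriangulation is a sequence
  of bistellar flips, and these preserve the homeomorphism type because they are realised by
  an explicit piecewise linear map in barycentric coordinates.
\<close>

section \<open>Bistellar flips and stellar subdivisions\<close>

lemma top_of_set_homeomorphicI:
  assumes "continuous_on S f" "continuous_on T g"
    and "\<And>x. x \<in> S \<Longrightarrow> f x \<in> T" "\<And>y. y \<in> T \<Longrightarrow> g y \<in> S"
    and "\<And>x. x \<in> S \<Longrightarrow> g (f x) = x" "\<And>y. y \<in> T \<Longrightarrow> f (g y) = y"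
  shows "top_of_set S homeomorphic_space top_of_set T"
  unfolding homeomorphic_space_def homeomorphic_maps_def
  using assms by (intro exI[of _ f] exI[of _ g]) (auto simp: image_subset_iff)

definition realization_points :: "'a set set \<Rightarrow> ('a \<Rightarrow> real) set" where
  "realization_points K =
     {x. (\<forall>v. 0 \<le> x v) \<and> {v. x v \<noteq> 0} \<in> K \<and> (\<Sum>v | x v \<noteq> 0. x v) = 1}"

text \<open>The product topology on real-valued functions is the topology of the type class, so maps
  between realizations can be treated with \<open>continuous_on\<close>.\<close>

lemma geometric_realization_top_of_set:
  "geometric_realization K = top_of_set (realization_points K)"
  unfolding geometric_realization_def realization_points_def euclidean_product_topology ..

lemma continuous_on_Min_coordinates:
  fixes S :: "('a \<Rightarrow> real) set"
  assumes "finite C" "C \<noteq> {}"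
  shows "continuous_on S (\<lambda>x. Min (x ` C))"
  using assms
proof (induction rule: finite_ne_induct)
  case (singleton v)
  then show ?case
    by (simp add: continuous_on_product_coordinates[THEN continuous_on_subset])
next
  case (insert v F)
  have "(\<lambda>x. Min (x ` insert v F)) = (\<lambda>x::'a \<Rightarrow> real. min (x v) (Min (x ` F)))"
    using insert by simp
  then show ?case
    using insert by (simp add: continuous_on_min continuous_on_product_coordinates[THEN continuous_on_subset])
qed

text \<open>
  Moves a point of a face containing \<open>C\<close> away from \<open>C\<close> towards \<open>A\<close> until some coordinate on \<open>C\<close>
  vanishes. If \<open>A\<close> is not a face, some coordinate on \<open>A\<close> vanished before, so \<open>push A C\<close> undoes the move;
  points with a vanishing coordinate on \<open>C\<close> are fixed.
\<close>

definition push :: "'a set \<Rightarrow> 'a set \<Rightarrow> ('a \<Rightarrow> real) \<Rightarrow> 'a \<Rightarrow> real" where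
  "push C A x v = x v + (if v \<in> A then real (card C) * Min (x ` C) / real (card A)
                         else if v \<in> C then - Min (x ` C) else 0)"

lemma continuous_on_push:
  assumes "finite C" "C \<noteq> {}"
  shows "continuous_on S (push C A)"
proof (rule continuous_on_coordinatewise_then_product)
  fix v
  show "continuous_on S (\<lambda>x. push C A x v)"
    unfolding push_def divide_inverse
    by (cases "v \<in> A"; cases "v \<in> C")
      (auto intro!: continuous_intros continuous_on_Min_coordinates assms
        continuous_on_product_coordinates[THEN continuous_on_subset])
qed

lemma push_trivial: "Min (x ` C) = 0 \<Longrightarrow> push C A x = x"
  by (auto simp: push_def)

text \<open>Before the move the minimum on \<open>A\<close> is 0; after it the minimum is
  \<open>\<nu>\<close>, the weight each vertex of \<open>A\<close> gained. The reverse move thus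
  takes back exactly that and returns \<open>\<mu>\<close> to each vertex of
  \<open>C\<close>.\<close>

lemma push_push:
  assumes "finite C" "finite A" "C \<noteq> {}" "A \<noteq> {}" "C \<inter> A = {}"
    and nonneg: "\<And>v. 0 \<le> x v" and a: "a \<in> A" "x a = 0"
  shows "push A C (push C A x) = x"
proof -
  define \<mu> where "\<mu> = Min (x ` C)"
  define \<nu> where "\<nu> = real (card C) * \<mu> / real (card A)"
  have push: "push C A x v = x v + (if v \<in> A then \<nu> else if v \<in> C then - \<mu> else 0)" for v
    by (simp add: push_def \<mu>_def \<nu>_def)
  have "push C A x ` A = (\<lambda>t. t + \<nu>) ` (x ` A)"
    by (auto simp: push image_image)
  also have "Min \<dots> = Min (x ` A) + \<nu>"
    using assms by (intro mono_Min_commute[symmetric]) (auto simp: mono_def)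
  also have "Min (x ` A) = 0"
    using assms by (intro Min_eqI) (auto simp: image_iff intro!: bexI[of _ a])
  finally have Min: "Min (push C A x ` A) = \<nu>" by simp
  have "real (card A) * \<nu> / real (card C) = \<mu>"
    using assms by (simp add: \<nu>_def card_eq_0_iff)
  then show ?thesis
    using \<open>C \<inter> A = {}\<close> unfolding push_def[of A C "push C A x"] Min by (intro ext) (auto simp: push)
qed

text \<open>A point whose support omits a vertex of \<open>C\<close> stays put. Otherwise the
  support gains all of \<open>A\<close> and loses a vertex of \<open>C\<close> of least weight.
  \<open>old\<close> and \<open>new\<close> say that the supports arising in these two cases are
  faces of \<open>K'\<close>.\<close>

lemma push_realization_points:
  assumes fin: "finite C" "finite A" and ne: "C \<noteq> {}" "A \<noteq> {}" "C \<inter> A = {}"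
    and K: "\<And>F. F \<in> K \<Longrightarrow> finite F"
    and old: "\<And>F. F \<in> K \<Longrightarrow> \<not> C \<subseteq> F \<Longrightarrow> F \<in> K'"
    and new: "\<And>F G. F \<in> K \<Longrightarrow> C \<subseteq> F \<Longrightarrow> G \<subseteq> F \<union> A \<Longrightarrow> A \<subseteq> G \<Longrightarrow> \<not> C \<subseteq> G \<Longrightarrow> G \<in> K'"
    and x: "x \<in> realization_points K"
  shows "push C A x \<in> realization_points K'"
proof -
  let ?F = "{v. x v \<noteq> 0}" and ?\<mu> = "Min (x ` C)"
  have nonneg: "\<And>v. 0 \<le> x v" and F: "?F \<in> K" and sum: "(\<Sum>v\<in>?F. x v) = 1"
    using x by (auto simp: realization_points_def)
  obtain c where c: "c \<in> C" "x c = ?\<mu>"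
  proof -
    have "?\<mu> \<in> x ` C" using fin ne by (intro Min_in) auto
    then show ?thesis using that by auto
  qed
  have le: "?\<mu> \<le> x v" if "v \<in> C" for v
    using that fin by simp
  show ?thesis
  proof (cases "C \<subseteq> ?F")
    case False
    then obtain d where "d \<in> C" "x d = 0" by auto
    then have "?\<mu> = 0" using le[of d] nonneg[of c] c by simp
    then show ?thesis
      using old[OF F False] nonneg sum by (simp add: push_trivial realization_points_def)
  next
    case True
    let ?G = "{v. push C A x v \<noteq> 0}"
    have \<mu>: "?\<mu> > 0"
      using True c nonneg[of c] by fastforce
    have card: "0 < real (card C)" "0 < real (card A)"
      using fin ne by (simp_all add: card_gt_0_iff)
    have pA: "push C A x v > 0" if "v \<in> A" for v
      using that \<mu> card nonneg[of v] by (simp add: push_def add_nonneg_pos)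
    have c0: "push C A x c = 0"
      using c ne by (auto simp: push_def)
    have nonneg': "0 \<le> push C A x v" for v
      using pA[of v] le[of v] nonneg[of v] by (cases "v \<in> A") (auto simp: push_def)
    have G: "?G \<subseteq> ?F \<union> A" using True by (auto simp: push_def)
    have "A \<subseteq> ?G" using pA by force
    moreover have "\<not> C \<subseteq> ?G" using c c0 by auto
    ultimately have "?G \<in> K'" using new[OF F True G] by simp
    moreover have "(\<Sum>v\<in>?G. push C A x v) = 1"
    proof -
      \<comment> \<open>Over this common finite set the total change is zero: \<open>C\<close> loses
        \<open>card C * ?\<mu>\<close> and \<open>A\<close> gains the same amount.\<close>
      let ?W = "?F \<union> A"
      have W: "finite ?W" "A \<subseteq> ?W" "C \<subseteq> ?W" using K[OF F] fin True by auto
      have "(\<Sum>v\<in>?G. push C A x v) = (\<Sum>v\<in>?W. push C A x v)"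
        using W G by (intro sum.mono_neutral_left) auto
      also have "\<dots> = (\<Sum>v\<in>?W. x v + ((if v \<in> A then card C * ?\<mu> / card A else 0)
          + (if v \<in> C then - ?\<mu> else 0)))"
        using ne by (intro sum.cong) (auto simp: push_def)
      also have "\<dots> = (\<Sum>v\<in>?W. x v) + ((\<Sum>v\<in>?W \<inter> A. card C * ?\<mu> / card A) + (\<Sum>v\<in>?W \<inter> C. - ?\<mu>))"
        by (simp only: sum.distrib sum.inter_restrict[OF W(1)])
      also have "?W \<inter> A = A" using W by auto
      also have "?W \<inter> C = C" using W by auto
      also have "(\<Sum>v\<in>?W. x v) = (\<Sum>v\<in>?F. x v)"
        using W by (intro sum.mono_neutral_right) auto
      finally show ?thesis using sum card by simp
    qed
    ultimately show ?thesis
      using nonneg' by (simp add: realization_points_def)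
  qed
qed

text \<open>The hypotheses are invariant under exchanging \<open>C\<close>, \<open>K\<close> with
  \<open>A\<close>, \<open>K'\<close>, so one lemma serves both directions. That no face of
  \<open>K\<close> contains \<open>A\<close> and none of \<open>K'\<close> contains \<open>C\<close>
  supplies the zero coordinates that make the two pushes inverse to each other.\<close>

theorem homeomorphic_space_push:
  assumes "finite C" "finite A" "C \<noteq> {}" "A \<noteq> {}" "C \<inter> A = {}"
    and K: "\<And>F. F \<in> K \<Longrightarrow> finite F \<and> \<not> A \<subseteq> F"
    and K': "\<And>G. G \<in> K' \<Longrightarrow> finite G \<and> \<not> C \<subseteq> G"
    and "\<And>F. F \<in> K \<Longrightarrow> \<not> C \<subseteq> F \<Longrightarrow> F \<in> K'"
    and "\<And>F G. F \<in> K \<Longrightarrow> C \<subseteq> F \<Longrightarrow> G \<subseteq> F \<union> A \<Longrightarrow> A \<subseteq> G \<Longrightarrow> \<not> C \<subseteq> G \<Longrightarrow> G \<in> K'"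
    and "\<And>G. G \<in> K' \<Longrightarrow> \<not> A \<subseteq> G \<Longrightarrow> G \<in> K"
    and "\<And>F G. G \<in> K' \<Longrightarrow> A \<subseteq> G \<Longrightarrow> F \<subseteq> G \<union> C \<Longrightarrow> C \<subseteq> F \<Longrightarrow> \<not> A \<subseteq> F \<Longrightarrow> F \<in> K"
  shows "geometric_realization K homeomorphic_space geometric_realization K'"
  unfolding geometric_realization_top_of_set
proof (rule top_of_set_homeomorphicI[of _ "push C A" _ "push A C"])
  show "continuous_on (realization_points K) (push C A)"
    and "continuous_on (realization_points K') (push A C)"
    using assms(1-4) by (simp_all add: continuous_on_push)
  have fin: "\<And>F. F \<in> K \<Longrightarrow> finite F" "\<And>G. G \<in> K' \<Longrightarrow> finite G"
    using K K' by blast+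
  have "A \<inter> C = {}" using assms(5) by blast
  show "push C A x \<in> realization_points K'" if "x \<in> realization_points K" for x
    by (rule push_realization_points[OF assms(1-5) fin(1) assms(8,9) that])
  show "push A C y \<in> realization_points K" if "y \<in> realization_points K'" for y
    by (rule push_realization_points[OF assms(2,1,4,3) \<open>A \<inter> C = {}\<close> fin(2) assms(10,11) that])
  show "push A C (push C A x) = x" if "x \<in> realization_points K" for x
  proof -
    have "{v. x v \<noteq> 0} \<in> K" "\<And>v. 0 \<le> x v" using that by (auto simp: realization_points_def)
    moreover from K[OF this(1)] obtain a where "a \<in> A" "x a = 0" by auto
    ultimately show ?thesis using assms(1-5) push_push[of C A x a] by blast
  qed
  show "push C A (push A C y) = y" if "y \<in> realization_points K'" for y
  proof -
    have "{v. y v \<noteq> 0} \<in> K'" "\<And>v. 0 \<le> y v" using that by (auto simp: realization_points_def)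
    moreover from K'[OF this(1)] obtain a where "a \<in> C" "y a = 0" by auto
    ultimately show ?thesis using assms(1-5) \<open>A \<inter> C = {}\<close> push_push[of A C y a] by blast
  qed
qed

section \<open>Flips and subdivisions in terms of facets\<close>

definition down_closure :: "'a set set \<Rightarrow> 'a set set" where
  "down_closure \<F> = {s. \<exists>T\<in>\<F>. s \<subseteq> T}"

text \<open>The hypotheses make the link of \<open>C\<close> the boundary of the simplex
  \<open>A\<close>. The flip replaces the join of \<open>C\<close> with the boundary of
  \<open>A\<close> by the join of \<open>A\<close> with the boundary of \<open>C\<close>.\<close>

theorem bistellar_flip:
  assumes "finite C" "finite A" "C \<noteq> {}" "A \<noteq> {}" "C \<inter> A = {}"
    and fin: "\<And>T. T \<in> \<F> \<Longrightarrow> finite T"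
    and A: "\<And>T. T \<in> \<F> \<Longrightarrow> \<not> A \<subseteq> T"
    and link: "\<And>T. T \<in> \<F> \<Longrightarrow> C \<subseteq> T \<Longrightarrow> T \<subseteq> A \<union> C"
    and facets: "\<And>a. a \<in> A \<Longrightarrow> A \<union> C - {a} \<in> \<F>"
    and \<F>': "\<F>' = {T \<in> \<F>. \<not> C \<subseteq> T} \<union> (\<lambda>c. A \<union> C - {c}) ` C"
  shows "geometric_realization (down_closure \<F>) homeomorphic_space
         geometric_realization (down_closure \<F>')"
proof (rule homeomorphic_space_push[of C A])
  show "finite F \<and> \<not> A \<subseteq> F" if "F \<in> down_closure \<F>" for F
    using that fin A unfolding down_closure_def by (blast dest: finite_subset)
  show "finite G \<and> \<not> C \<subseteq> G" if G: "G \<in> down_closure \<F>'" for G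
  proof -
    obtain T where T: "T \<in> \<F>'" "G \<subseteq> T" using G by (auto simp: down_closure_def)
    then have "finite T \<and> \<not> C \<subseteq> T" unfolding \<F>' using fin assms(1,2) by auto
    with T show ?thesis by (auto dest: finite_subset)
  qed
  \<comment> \<open>Inside the simplex \<open>A \<union> C\<close> the added facets generate all
    faces not containing \<open>C\<close>; dually, in \<open>old\<close>, the removed ones generate
    all faces not containing \<open>A\<close>.\<close>
  have new: "G \<in> down_closure \<F>'" if G: "G \<subseteq> A \<union> C" "\<not> C \<subseteq> G" for G
  proof -
    obtain c where "c \<in> C" "c \<notin> G" using G by auto
    then show ?thesis using G unfolding down_closure_def \<F>'
      by (intro CollectI bexI[of _ "A \<union> C - {c}"]) auto
  qed
  show "F \<in> down_closure \<F>'" if F: "F \<in> down_closure \<F>" "\<not> C \<subseteq> F" for F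
  proof -
    obtain T where T: "T \<in> \<F>" "F \<subseteq> T" using F by (auto simp: down_closure_def)
    show ?thesis
    proof (cases "C \<subseteq> T")
      case True
      then show ?thesis using T link[of T] F by (intro new) auto
    next
      case False
      then show ?thesis using T by (auto simp: down_closure_def \<F>')
    qed
  qed
  show "G \<in> down_closure \<F>'"
    if F: "F \<in> down_closure \<F>" "C \<subseteq> F" "G \<subseteq> F \<union> A" "\<not> C \<subseteq> G" for F G
  proof -
    obtain T where "T \<in> \<F>" "F \<subseteq> T" using F by (auto simp: down_closure_def)
    then show ?thesis using link[of T] F by (intro new) auto
  qed
  have old: "F \<in> down_closure \<F>" if F: "F \<subseteq> A \<union> C" "\<not> A \<subseteq> F" for F
  proof -
    obtain a where "a \<in> A" "a \<notin> F" using F by auto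
    then show ?thesis using facets[of a] F unfolding down_closure_def
      by (intro CollectI bexI[of _ "A \<union> C - {a}"]) auto
  qed
  show "G \<in> down_closure \<F>" if G: "G \<in> down_closure \<F>'" "\<not> A \<subseteq> G" for G
  proof -
    obtain T where T: "T \<in> \<F>'" "G \<subseteq> T" using G by (auto simp: down_closure_def)
    then consider "T \<in> \<F>" | "T \<subseteq> A \<union> C" by (auto simp: \<F>')
    then show ?thesis
      using T G old[of G] by cases (auto simp: down_closure_def)
  qed
  show "F \<in> down_closure \<F>"
    if G: "G \<in> down_closure \<F>'" "A \<subseteq> G" "F \<subseteq> G \<union> C" "\<not> A \<subseteq> F" for F G
  proof -
    obtain T where T: "T \<in> \<F>'" "G \<subseteq> T" using G by (auto simp: down_closure_def)
    then have "T \<subseteq> A \<union> C" using A[of T] G by (auto simp: \<F>')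
    then show ?thesis using T G by (intro old) auto
  qed
qed (use assms(1-5) in auto)

text \<open>The push with \<open>A = {v}\<close>. Since \<open>v\<close> is a new vertex, the link
  of \<open>C\<close> may be arbitrary.\<close>

theorem stellar_subdivision:
  assumes C: "finite C" "C \<noteq> {}"
    and fin: "\<And>T. T \<in> \<F> \<Longrightarrow> finite T" and v: "\<And>T. T \<in> \<F> \<Longrightarrow> v \<notin> T" "v \<notin> C"
    and \<F>': "\<F>' = {T \<in> \<F>. \<not> C \<subseteq> T} \<union> {insert v (T - {c}) | T c. T \<in> \<F> \<and> C \<subseteq> T \<and> c \<in> C}"
  shows "geometric_realization (down_closure \<F>) homeomorphic_space
         geometric_realization (down_closure \<F>')"
proof (rule homeomorphic_space_push[of C "{v}"])
  show "finite F \<and> \<not> {v} \<subseteq> F" if "F \<in> down_closure \<F>" for F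
    using that fin v unfolding down_closure_def by (blast dest: finite_subset)
  show "finite G \<and> \<not> C \<subseteq> G" if G: "G \<in> down_closure \<F>'" for G
  proof -
    obtain T where T: "T \<in> \<F>'" "G \<subseteq> T" using G by (auto simp: down_closure_def)
    then have "finite T \<and> \<not> C \<subseteq> T" unfolding \<F>' using fin v by auto
    with T show ?thesis by (auto dest: finite_subset)
  qed
  have new: "G \<in> down_closure \<F>'" if T: "T \<in> \<F>" "C \<subseteq> T" "G \<subseteq> insert v T" "\<not> C \<subseteq> G" for T G
  proof -
    obtain c where c: "c \<in> C" "c \<notin> G" using T by auto
    have "insert v (T - {c}) \<in> \<F>'" using T c unfolding \<F>' by blast
    moreover have "G \<subseteq> insert v (T - {c})" using T c by auto
    ultimately show ?thesis unfolding down_closure_def by blast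
  qed
  show "F \<in> down_closure \<F>'" if F: "F \<in> down_closure \<F>" "\<not> C \<subseteq> F" for F
  proof -
    obtain T where T: "T \<in> \<F>" "F \<subseteq> T" using F by (auto simp: down_closure_def)
    show ?thesis
    proof (cases "C \<subseteq> T")
      case True
      then show ?thesis using T F by (intro new[of T]) auto
    next
      case False
      then show ?thesis using T by (auto simp: down_closure_def \<F>')
    qed
  qed
  show "G \<in> down_closure \<F>'"
    if F: "F \<in> down_closure \<F>" "C \<subseteq> F" "G \<subseteq> F \<union> {v}" "\<not> C \<subseteq> G" for F G
  proof -
    obtain T where "T \<in> \<F>" "F \<subseteq> T" using F by (auto simp: down_closure_def)
    then show ?thesis using F by (intro new[of T]) auto
  qed
  show "G \<in> down_closure \<F>" if G: "G \<in> down_closure \<F>'" "\<not> {v} \<subseteq> G" for G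
  proof -
    obtain T where T: "T \<in> \<F>'" "G \<subseteq> T" using G by (auto simp: down_closure_def)
    then consider "T \<in> \<F>" | U where "U \<in> \<F>" "T \<subseteq> insert v U" by (auto simp: \<F>')
    then show ?thesis
      using T G by cases (auto simp: down_closure_def)
  qed
  show "F \<in> down_closure \<F>"
    if G: "G \<in> down_closure \<F>'" "{v} \<subseteq> G" "F \<subseteq> G \<union> C" "\<not> {v} \<subseteq> F" for F G
  proof -
    obtain T where T: "T \<in> \<F>'" "G \<subseteq> T" using G by (auto simp: down_closure_def)
    then have "T \<notin> \<F>" using v G by auto
    then obtain U c where U: "U \<in> \<F>" "C \<subseteq> U" "T = insert v (U - {c})"
      using T unfolding \<F>' by blast
    then have "F \<subseteq> U" using T G by auto
    then show ?thesis using U unfolding down_closure_def by blast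
  qed
qed (use C v(2) in auto)

section \<open>Joins of two cycles\<close>

text \<open>With the closing edge kept apart, passing from \<open>k\<close> to \<open>Suc k\<close>
  only replaces that edge by a path of two edges through \<open>p k\<close>.\<close>

definition cycle_edges :: "(nat \<Rightarrow> 'a) \<Rightarrow> nat \<Rightarrow> 'a set set" where
  "cycle_edges p k = {{p i, p (Suc i)} | i. Suc i < k} \<union> {{p (k - 1), p 0}}"

definition join_facets :: "'a set set \<Rightarrow> 'a set set \<Rightarrow> 'a set set" where
  "join_facets E F = {e \<union> f | e f. e \<in> E \<and> f \<in> F}"

lemma join_facets_commute: "join_facets E F = join_facets F E"
  by (auto simp: join_facets_def Un_commute)

lemma join_facets_insert: "join_facets (insert e E) F = (\<lambda>f. e \<union> f) ` F \<union> join_facets E F"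
  unfolding join_facets_def by blast

lemma join_facets_Un: "join_facets (E \<union> E') F = join_facets E F \<union> join_facets E' F"
  unfolding join_facets_def by blast

lemma join_facets_empty: "join_facets {} F = {}"
  unfolding join_facets_def by blast

lemma cycle_edges_3: "cycle_edges p 3 = {{p 0, p 1}, {p 1, p 2}, {p 2, p 0}}"
proof -
  have "{{p i, p (Suc i)} | i. Suc i < 3} = (\<lambda>i. {p i, p (Suc i)}) ` {0, 1}"
    by (force simp: less_Suc_eq numeral_3_eq_3)
  then show ?thesis by (auto simp: cycle_edges_def numeral_2_eq_2)
qed

section \<open>The join of two triangle boundaries is a 3-sphere\<close>

text \<open>
  The projection \<open>diffs\<close> to \<open>\<real>\<^sup>4\<close> is inverted by \<open>lift\<close> since a point of the join of two triangle boundaries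
  has a vanishing coordinate on each triangle.
\<close>

locale two_triangles =
  fixes a b c d e f :: 'a
  assumes distinct_vertices: "distinct [a, b, c, d, e, f]"
begin

lemma vertices_neq:
  "a \<noteq> b" "a \<noteq> c" "a \<noteq> d" "a \<noteq> e" "a \<noteq> f" "b \<noteq> c" "b \<noteq> d" "b \<noteq> e" "b \<noteq> f"
  "c \<noteq> d" "c \<noteq> e" "c \<noteq> f" "d \<noteq> e" "d \<noteq> f" "e \<noteq> f"
  using distinct_vertices by auto

definition six_vertex_sphere :: "'a set set" where
  "six_vertex_sphere = down_closure (join_facets {{a, b}, {b, c}, {c, a}} {{d, e}, {e, f}, {f, d}})"

lemma mem_six_vertex_sphere:
  "s \<in> six_vertex_sphere \<longleftrightarrow> s \<subseteq> {a, b, c, d, e, f} \<and> \<not> {a, b, c} \<subseteq> s \<and> \<not> {d, e, f} \<subseteq> s"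
proof
  assume "s \<in> six_vertex_sphere"
  then show "s \<subseteq> {a, b, c, d, e, f} \<and> \<not> {a, b, c} \<subseteq> s \<and> \<not> {d, e, f} \<subseteq> s"
    using vertices_neq by (auto simp: six_vertex_sphere_def down_closure_def join_facets_def)
next
  assume s: "s \<subseteq> {a, b, c, d, e, f} \<and> \<not> {a, b, c} \<subseteq> s \<and> \<not> {d, e, f} \<subseteq> s"
  obtain u where u: "u \<in> {{a, b}, {b, c}, {c, a}}" "s \<inter> {a, b, c} \<subseteq> u"
    using s by auto
  obtain w where w: "w \<in> {{d, e}, {e, f}, {f, d}}" "s \<inter> {d, e, f} \<subseteq> w"
    using s by auto
  have "s \<subseteq> u \<union> w" using s u w by auto
  with u w show "s \<in> six_vertex_sphere" unfolding six_vertex_sphere_def down_closure_def join_facets_def by blast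
qed

definition total :: "('a \<Rightarrow> real) \<Rightarrow> real" where
  "total x = x a + x b + x c + x d + x e + x f"

lemma mem_realization_points:
  "x \<in> realization_points six_vertex_sphere \<longleftrightarrow>
     (\<forall>v. 0 \<le> x v) \<and> (\<forall>v. v \<notin> {a, b, c, d, e, f} \<longrightarrow> x v = 0) \<and>
     (x a = 0 \<or> x b = 0 \<or> x c = 0) \<and> (x d = 0 \<or> x e = 0 \<or> x f = 0) \<and> total x = 1"
proof -
  have "(\<Sum>v | x v \<noteq> 0. x v) = total x" if "{v. x v \<noteq> 0} \<subseteq> {a, b, c, d, e, f}"
  proof -
    have "(\<Sum>v | x v \<noteq> 0. x v) = (\<Sum>v\<in>{a, b, c, d, e, f}. x v)"
      using that by (intro sum.mono_neutral_left) auto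
    then show ?thesis using vertices_neq by (simp add: total_def)
  qed
  moreover have "{v. x v \<noteq> 0} \<subseteq> {a, b, c, d, e, f} \<longleftrightarrow> (\<forall>v. v \<notin> {a, b, c, d, e, f} \<longrightarrow> x v = 0)"
    by blast
  ultimately show ?thesis
    unfolding realization_points_def mem_Collect_eq mem_six_vertex_sphere insert_subset by auto
qed

text \<open>On functions supported on the six vertices, a linear map with kernel spanned by the
  indicators of the two triangles. Values beyond index 3 are 0, as in
  \<open>nsphere 3\<close>.\<close>

definition diffs :: "('a \<Rightarrow> real) \<Rightarrow> nat \<Rightarrow> real" where
  "diffs x i = (if i = 0 then x a - x c else if i = 1 then x b - x c
     else if i = 2 then x d - x f else if i = 3 then x e - x f else 0)"

text \<open>Puts weights \<open>y 0, y 1, 0\<close> and \<open>y 2, y 3, 0\<close> on the triangles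
  and shifts each triple by the constant that brings its minimum to 0.\<close>

definition lift :: "(nat \<Rightarrow> real) \<Rightarrow> 'a \<Rightarrow> real" where
  "lift y v = (let \<mu> = min 0 (min (y 0) (y 1)); \<nu> = min 0 (min (y 2) (y 3)) in
     if v = a then y 0 - \<mu> else if v = b then y 1 - \<mu> else if v = c then - \<mu>
     else if v = d then y 2 - \<nu> else if v = e then y 3 - \<nu> else if v = f then - \<nu> else 0)"

definition radius :: "(nat \<Rightarrow> real) \<Rightarrow> real" where
  "radius y = sqrt ((y 0)\<^sup>2 + (y 1)\<^sup>2 + (y 2)\<^sup>2 + (y 3)\<^sup>2)"

definition sphere_points :: "(nat \<Rightarrow> real) set" where
  "sphere_points = {y. (\<Sum>i\<le>3. (y i)\<^sup>2) = 1 \<and> (\<forall>i>3. y i = 0)}"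

lemma mem_sphere_points: "y \<in> sphere_points \<longleftrightarrow> radius y = 1 \<and> (\<forall>i>3. y i = 0)"
  by (simp add: sphere_points_def radius_def eval_nat_numeral atMost_Suc add_ac)

lemma lift_diffs:
  assumes "x \<in> realization_points six_vertex_sphere"
  shows "lift (diffs x) = x"
proof
  fix v
  have nonneg: "0 \<le> x a" "0 \<le> x b" "0 \<le> x c" "0 \<le> x d" "0 \<le> x e" "0 \<le> x f"
    and zero: "x a = 0 \<or> x b = 0 \<or> x c = 0" "x d = 0 \<or> x e = 0 \<or> x f = 0"
    and out: "v \<notin> {a, b, c, d, e, f} \<Longrightarrow> x v = 0"
    using assms by (auto simp: mem_realization_points)
  \<comment> \<open>The minimum of the three weights on either triangle is 0, and subtracting the
    third weight from all of them shifts it.\<close>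
  have min: "min 0 (min (x a - x c) (x b - x c)) = - x c" "min 0 (min (x d - x f) (x e - x f)) = - x f"
    using nonneg zero by linarith+
  have diffs: "diffs x 0 = x a - x c" "diffs x 1 = x b - x c" "diffs x 2 = x d - x f" "diffs x 3 = x e - x f"
    by (simp_all add: diffs_def)
  have "lift (diffs x) v = (if v = a then x a else if v = b then x b else if v = c then x c
      else if v = d then x d else if v = e then x e else if v = f then x f else 0)"
    by (simp only: lift_def Let_def diffs min diff_minus_eq_add diff_add_cancel minus_minus)
  then show "lift (diffs x) v = x v" using out by auto
qed

lemma lift_vertices:
  "lift y a = y 0 - min 0 (min (y 0) (y 1))" "lift y b = y 1 - min 0 (min (y 0) (y 1))"
  "lift y c = - min 0 (min (y 0) (y 1))" "lift y d = y 2 - min 0 (min (y 2) (y 3))"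
  "lift y e = y 3 - min 0 (min (y 2) (y 3))" "lift y f = - min 0 (min (y 2) (y 3))"
  by (simp_all add: lift_def Let_def vertices_neq vertices_neq[symmetric])

lemma diffs_lift:
  assumes "\<forall>i>3. y i = 0"
  shows "diffs (lift y) = y"
proof
  fix i :: nat
  consider "i = 0" | "i = 1" | "i = 2" | "i = 3" | "i > 3" by linarith
  then show "diffs (lift y) i = y i"
    using assms by cases (simp_all only: diffs_def lift_vertices, simp_all)
qed

lemma diffs_gt_3: "i > 3 \<Longrightarrow> diffs x i = 0"
  by (simp add: diffs_def)

text \<open>This and the next three lemmas record positive homogeneity: both directions of the
  homeomorphism normalise, one by the radius and the other by the total weight.\<close>

lemma diffs_scale: "diffs (\<lambda>v. x v / t) = (\<lambda>i. diffs x i / t)"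
  by (auto simp: diffs_def diff_divide_distrib)

lemma lift_scale:
  assumes "t > 0"
  shows "lift (\<lambda>i. y i / t) = (\<lambda>v. lift y v / t)"
proof -
  have "min 0 (min (y i / t) (y j / t)) = min 0 (min (y i) (y j)) / t" for i j
    using assms by (simp add: min_def divide_right_mono divide_le_cancel not_less)
      (auto simp: divide_simps)
  then show ?thesis
    by (auto simp: lift_def Let_def diff_divide_distrib fun_eq_iff)
qed

lemma radius_scale: "t > 0 \<Longrightarrow> radius (\<lambda>i. y i / t) = radius y / t"
  by (simp add: radius_def power_divide add_divide_distrib[symmetric] real_sqrt_divide)

lemma total_scale: "total (\<lambda>v. x v / t) = total x / t"
  by (simp add: total_def add_divide_distrib)

text \<open>All six weights are nonnegative, and they vanish together only if \<open>y\<close>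
  vanishes on the first four indices, which the radius excludes.\<close>

lemma total_lift_pos:
  assumes "radius y = 1"
  shows "total (lift y) > 0"
proof -
  define \<mu> \<nu> where "\<mu> = min 0 (min (y 0) (y 1))" and "\<nu> = min 0 (min (y 2) (y 3))"
  have "\<not> (y 0 = 0 \<and> y 1 = 0 \<and> y 2 = 0 \<and> y 3 = 0)"
    using assms by (auto simp: radius_def)
  moreover have "\<mu> \<le> 0" "\<mu> \<le> y 0" "\<mu> \<le> y 1" "\<nu> \<le> 0" "\<nu> \<le> y 2" "\<nu> \<le> y 3"
    by (auto simp: \<mu>_def \<nu>_def)
  ultimately show ?thesis
    unfolding total_def lift_vertices \<mu>_def[symmetric] \<nu>_def[symmetric] by linarith
qed

text \<open>If all differences vanished, \<open>x = lift (diffs x)\<close> would be 0, contradicting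
  total weight 1.\<close>

lemma radius_diffs_pos:
  assumes "x \<in> realization_points six_vertex_sphere"
  shows "radius (diffs x) > 0"
proof (rule ccontr)
  have "radius y \<ge> 0" for y by (simp add: radius_def)
  moreover assume "\<not> radius (diffs x) > 0"
  ultimately have "radius (diffs x) = 0" by (metis less_eq_real_def)
  then have "diffs x 0 = 0" "diffs x 1 = 0" "diffs x 2 = 0" "diffs x 3 = 0"
    by (simp_all add: radius_def sum_power2_eq_zero_iff add_nonneg_eq_0_iff)
  then have "lift (diffs x) = (\<lambda>v. 0)" by (auto simp: lift_def Let_def)
  then show False using assms lift_diffs[OF assms] by (simp add: mem_realization_points total_def)
qed

lemma lift_nonneg: "0 \<le> lift y v"
  by (auto simp: lift_def Let_def)

text \<open>Every ray from the origin of 4-space meets the image of the realization under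
  \<open>diffs\<close> exactly once, so dividing by the radius gives a bijection onto the sphere.
  The inverse lifts and rescales to total weight 1.\<close>

theorem homeomorphic_sphere: "geometric_realization six_vertex_sphere homeomorphic_space nsphere 3"
proof -
  let ?\<phi> = "\<lambda>x i. diffs x i / radius (diffs x)" and ?\<psi> = "\<lambda>y v. lift y v / total (lift y)"
  have coord: "continuous_on S (\<lambda>x. x v)" for S :: "('c \<Rightarrow> real) set" and v
    by (rule continuous_on_subset[OF continuous_on_product_coordinates]) simp
  have "nsphere 3 = top_of_set sphere_points"
    unfolding nsphere sphere_points_def euclidean_product_topology ..
  moreover have "top_of_set (realization_points six_vertex_sphere) homeomorphic_space top_of_set sphere_points"
  proof (rule top_of_set_homeomorphicI[of _ ?\<phi> _ ?\<psi>])
    have diffs: "continuous_on S (\<lambda>x. diffs x i)" for S i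
      unfolding diffs_def by (cases "i = 0"; cases "i = 1"; cases "i = 2"; cases "i = 3")
        (auto intro!: continuous_intros coord)
    show "continuous_on (realization_points six_vertex_sphere) ?\<phi>"
    proof (intro continuous_on_coordinatewise_then_product continuous_on_divide diffs ballI)
      show "continuous_on (realization_points six_vertex_sphere) (\<lambda>x. radius (diffs x))"
        unfolding radius_def by (intro continuous_intros diffs)
    qed (use radius_diffs_pos in force)
    have lift: "continuous_on S (\<lambda>y. lift y v)" for S v
      unfolding lift_def Let_def
      by (cases "v = a"; cases "v = b"; cases "v = c"; cases "v = d"; cases "v = e"; cases "v = f")
        (auto intro!: continuous_intros coord)
    show "continuous_on sphere_points ?\<psi>"
    proof (intro continuous_on_coordinatewise_then_product continuous_on_divide lift ballI)
      show "continuous_on sphere_points (\<lambda>y. total (lift y))"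
        unfolding total_def by (intro continuous_intros lift)
    qed (use total_lift_pos in \<open>force simp: mem_sphere_points\<close>)
    show "?\<phi> x \<in> sphere_points" if "x \<in> realization_points six_vertex_sphere" for x
      using radius_diffs_pos[OF that] by (auto simp: mem_sphere_points radius_scale diffs_gt_3)
    show "?\<psi> y \<in> realization_points six_vertex_sphere" if "y \<in> sphere_points" for y
    proof -
      have pos: "total (lift y) > 0" using that total_lift_pos by (auto simp: mem_sphere_points)
      moreover have "lift y a = 0 \<or> lift y b = 0 \<or> lift y c = 0"
        "lift y d = 0 \<or> lift y e = 0 \<or> lift y f = 0"
        unfolding lift_vertices by linarith+
      moreover have "lift y v = 0" if "v \<notin> {a, b, c, d, e, f}" for v
        using that by (simp add: lift_def)
      ultimately show ?thesis
        using lift_nonneg[of y] by (auto simp: mem_realization_points total_scale)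
    qed
    show "?\<psi> (?\<phi> x) = x" if "x \<in> realization_points six_vertex_sphere" for x
    proof -
      have "lift (?\<phi> x) = (\<lambda>v. x v / radius (diffs x))"
        using lift_scale[OF radius_diffs_pos[OF that], of "diffs x"] lift_diffs[OF that] by simp
      moreover have "total x = 1" using that by (simp add: mem_realization_points)
      ultimately show ?thesis
        using radius_diffs_pos[OF that] by (simp add: total_scale)
    qed
    show "?\<phi> (?\<psi> y) = y" if "y \<in> sphere_points" for y
    proof -
      have y: "radius y = 1" "\<forall>i>3. y i = 0" using that by (auto simp: mem_sphere_points)
      have "diffs (?\<psi> y) = (\<lambda>i. y i / total (lift y))"
        using diffs_lift[OF y(2)] by (simp add: diffs_scale)
      then show ?thesis
        using total_lift_pos[OF y(1)] y(1) by (simp add: radius_scale)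
    qed
  qed
  ultimately show ?thesis by (simp add: geometric_realization_top_of_set)
qed

end

section \<open>Lengthening the cycles\<close>

lemma cycle_edges_subset: "k > 0 \<Longrightarrow> e \<in> cycle_edges p k \<Longrightarrow> e \<subseteq> p ` {..<k}"
  by (auto simp: cycle_edges_def)

text \<open>Stellar subdivision of the closing edge \<open>{p (k - 1), p 0}\<close> at the new
  vertex \<open>p k\<close>. The bound on \<open>k\<close> keeps this edge distinct from the other
  edges of the cycle.\<close>

lemma cycle_join_step:
  assumes k: "k \<ge> 3" and l: "l > 0" and inj: "inj_on p {..<Suc k}"
    and disj: "p ` {..<Suc k} \<inter> q ` {..<l} = {}"
  shows "geometric_realization (down_closure (join_facets (cycle_edges p k) (cycle_edges q l)))
    homeomorphic_space
    geometric_realization (down_closure (join_facets (cycle_edges p (Suc k)) (cycle_edges q l)))"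
proof (rule stellar_subdivision[of "{p (k - 1), p 0}" _ "p k"])
  let ?C = "{p (k - 1), p 0}"
  have p: "p i = p j \<longleftrightarrow> i = j" if "i \<le> k" "j \<le> k" for i j
    using inj_on_eq_iff[OF inj] that by auto
  have pq: "p i \<notin> f" if "i \<le> k" "f \<in> cycle_edges q l" for i f
  proof -
    have "p i \<in> p ` {..<Suc k}" using that by simp
    then show ?thesis using disj cycle_edges_subset[OF l that(2)] by blast
  qed
  have e: "p k \<notin> e" if "e \<in> cycle_edges p k" for e
    using that k p by (auto simp: cycle_edges_def)
  show "finite T" if "T \<in> join_facets (cycle_edges p k) (cycle_edges q l)" for T
    using that by (auto simp: join_facets_def cycle_edges_def)
  show "p k \<notin> T" if "T \<in> join_facets (cycle_edges p k) (cycle_edges q l)" for T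
    using that pq e by (auto simp: join_facets_def)
  show "p k \<notin> ?C" using k p[of k "k - 1"] p[of k 0] by auto
  let ?E = "{{p i, p (Suc i)} | i. Suc i < k}"
  \<comment> \<open>The second cycle avoids both ends of the closing edge, so only edges of the
    first one matter.\<close>
  have C_iff: "?C \<subseteq> e \<union> f \<longleftrightarrow> e = ?C" if "e \<in> cycle_edges p k" "f \<in> cycle_edges q l" for e f
  proof -
    have "?C \<subseteq> e \<union> f \<longleftrightarrow> ?C \<subseteq> e" using pq[OF _ that(2)] by auto
    also have "\<dots> \<longleftrightarrow> e = ?C"
    proof
      assume "?C \<subseteq> e"
      moreover have False if "e = {p i, p (Suc i)}" "Suc i < k" "?C \<subseteq> e" for i
        using that k p[of "k - 1" i] p[of "k - 1" "Suc i"] p[of 0 i] p[of 0 "Suc i"] by auto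
      ultimately show "e = ?C" using that(1) by (auto simp: cycle_edges_def)
    qed auto
    finally show ?thesis .
  qed
  have CE: "?C \<notin> ?E"
  proof
    assume "?C \<in> ?E"
    then obtain i where i: "?C = {p i, p (Suc i)}" "Suc i < k" by auto
    then show False using k p[of "k - 1" i] p[of "k - 1" "Suc i"] p[of 0 i] p[of 0 "Suc i"]
      by (auto simp: doubleton_eq_iff)
  qed
  have split: "cycle_edges p k = insert ?C ?E" by (auto simp: cycle_edges_def)
  have "cycle_edges p (Suc k) = ?E \<union> {{p (k - 1), p k}, {p k, p 0}}"
  proof -
    have "{{p i, p (Suc i)} | i. Suc i < Suc k} = insert {p (k - 1), p k} ?E"
      using k by (auto simp: less_Suc_eq)
    then show ?thesis by (auto simp: cycle_edges_def)
  qed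
  moreover have "{insert (p k) (insert x f) | x f. x \<in> ?C \<and> f \<in> cycle_edges q l}
      = (\<lambda>f. {p (k - 1), p k} \<union> f) ` cycle_edges q l \<union> (\<lambda>f. {p k, p 0} \<union> f) ` cycle_edges q l"
    by auto
  ultimately have J': "join_facets (cycle_edges p (Suc k)) (cycle_edges q l)
      = join_facets ?E (cycle_edges q l) \<union> {insert (p k) (insert x f) | x f. x \<in> ?C \<and> f \<in> cycle_edges q l}"
    by (simp only: join_facets_Un join_facets_insert join_facets_empty Un_empty_right)
  have 1: "{T \<in> join_facets (cycle_edges p k) (cycle_edges q l). \<not> ?C \<subseteq> T} = join_facets ?E (cycle_edges q l)"
    (is "?L = ?R")
  proof (intro equalityI subsetI)
    fix T assume "T \<in> ?L"
    then obtain e f where T: "T = e \<union> f" "e \<in> cycle_edges p k" "f \<in> cycle_edges q l" "\<not> ?C \<subseteq> T"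
      by (auto simp: join_facets_def)
    then have "e \<in> ?E" using C_iff[of e f] split by auto
    then show "T \<in> ?R" using T unfolding join_facets_def by blast
  next
    fix T assume "T \<in> ?R"
    then obtain e f where T: "T = e \<union> f" "e \<in> ?E" "f \<in> cycle_edges q l"
      unfolding join_facets_def by blast
    then have "e \<in> cycle_edges p k" "e \<noteq> ?C" using split CE by auto
    then show "T \<in> ?L" using T C_iff[of e f] unfolding join_facets_def by blast
  qed
  have 2: "{insert (p k) (T - {c}) | T c. T \<in> join_facets (cycle_edges p k) (cycle_edges q l) \<and> ?C \<subseteq> T \<and> c \<in> ?C}
     = {insert (p k) (insert x f) | x f. x \<in> ?C \<and> f \<in> cycle_edges q l}" (is "?L = ?R")
  proof -
    have ne: "p (k - 1) \<noteq> p 0" using k p[of "k - 1" 0] by auto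
    have "?C \<union> f - {p (k - 1)} = insert (p 0) f" "?C \<union> f - {p 0} = insert (p (k - 1)) f"
      if "f \<in> cycle_edges q l" for f
      using ne pq[OF _ that, of 0] pq[OF _ that, of "k - 1"] by auto
    note D = this
    show ?thesis
    proof (intro equalityI subsetI)
      fix U assume "U \<in> ?L"
      then obtain T c where T: "U = insert (p k) (T - {c})"
        "T \<in> join_facets (cycle_edges p k) (cycle_edges q l)" "?C \<subseteq> T" "c \<in> ?C" by blast
      then obtain e f where ef: "T = e \<union> f" "e \<in> cycle_edges p k" "f \<in> cycle_edges q l"
        unfolding join_facets_def by blast
      then have "T = ?C \<union> f" using C_iff[of e f] T by simp
      then have "U = insert (p k) (insert (p 0) f) \<or> U = insert (p k) (insert (p (k - 1)) f)"
        using T D[OF ef(3)] by auto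
      then show "U \<in> ?R" using ef(3) by blast
    next
      fix U assume "U \<in> ?R"
      then obtain x f where U: "U = insert (p k) (insert x f)" "x \<in> ?C" "f \<in> cycle_edges q l" by blast
      have J: "?C \<union> f \<in> join_facets (cycle_edges p k) (cycle_edges q l)"
        using U split unfolding join_facets_def by blast
      obtain c where c: "c \<in> ?C" "?C \<union> f - {c} = insert x f"
        using U D[OF U(3)] by blast
      have "?C \<subseteq> ?C \<union> f" by blast
      then show "U \<in> ?L" using J c U(1) by blast
    qed
  qed
  show "join_facets (cycle_edges p (Suc k)) (cycle_edges q l) =
    {T \<in> join_facets (cycle_edges p k) (cycle_edges q l). \<not> ?C \<subseteq> T} \<union>
    {insert (p k) (T - {c}) | T c. T \<in> join_facets (cycle_edges p k) (cycle_edges q l) \<and> ?C \<subseteq> T \<and> c \<in> ?C}"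
    unfolding 1 2 J' ..
qed auto

theorem cycle_join_sphere:
  assumes "k \<ge> 3" "l \<ge> 3" "inj_on p {..<k}" "inj_on q {..<l}" "p ` {..<k} \<inter> q ` {..<l} = {}"
  shows "geometric_realization (down_closure (join_facets (cycle_edges p k) (cycle_edges q l)))
    homeomorphic_space nsphere 3"
  using assms
proof (induction k rule: nat_induct_at_least)
  case base
  from base show ?case
  proof (induction l rule: nat_induct_at_least)
    case base
    have "p i \<noteq> q j" if "i < 3" "j < 3" for i j
      using base that by (metis IntI empty_iff imageI lessThan_iff)
    moreover have "p 0 \<noteq> p 1" "p 0 \<noteq> p 2" "p 1 \<noteq> p 2" "q 0 \<noteq> q 1" "q 0 \<noteq> q 2" "q 1 \<noteq> q 2"
      using base by (simp_all add: inj_on_eq_iff)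
    ultimately interpret two_triangles "p 0" "p 1" "p 2" "q 0" "q 1" "q 2"
      by unfold_locales simp
    show ?case using homeomorphic_sphere unfolding six_vertex_sphere_def cycle_edges_3 .
  next
    case (Suc l)
    \<comment> \<open>With the factors exchanged, \<open>cycle_join_step\<close> lengthens the
      second cycle; commutativity of the join translates back.\<close>
    have "geometric_realization (down_closure (join_facets (cycle_edges q l) (cycle_edges p 3)))
      homeomorphic_space
      geometric_realization (down_closure (join_facets (cycle_edges q (Suc l)) (cycle_edges p 3)))"
      using Suc.prems Suc.hyps by (intro cycle_join_step) auto
    moreover have "q ` {..<l} \<subseteq> q ` {..<Suc l}" by (intro image_mono) auto
    then have "inj_on q {..<l}" "p ` {..<3} \<inter> q ` {..<l} = {}"
      using Suc.prems by (auto intro: inj_on_subset)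
    ultimately show ?case
      using Suc.IH Suc.prems
      by (metis homeomorphic_space_sym homeomorphic_space_trans join_facets_commute)
  qed
next
  case (Suc k)
  have "p ` {..<k} \<subseteq> p ` {..<Suc k}" by (intro image_mono) auto
  then have "inj_on p {..<k}" "p ` {..<k} \<inter> q ` {..<l} = {}"
    using Suc.prems by (auto intro: inj_on_subset)
  moreover have "geometric_realization (down_closure (join_facets (cycle_edges p k) (cycle_edges q l)))
      homeomorphic_space
      geometric_realization (down_closure (join_facets (cycle_edges p (Suc k)) (cycle_edges q l)))"
    using Suc.prems Suc.hyps by (intro cycle_join_step) auto
  ultimately show ?case
    using Suc.IH Suc.prems by (metis homeomorphic_space_sym homeomorphic_space_trans)
qed

section \<open>Replacing the join of an edge and a path\<close>

definition path_join :: "'a \<Rightarrow> 'a \<Rightarrow> (nat \<Rightarrow> 'a) \<Rightarrow> nat \<Rightarrow> nat \<Rightarrow> 'a set set" where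
  "path_join p q x h n = (\<lambda>c. {p, q, x c, x (Suc c)}) ` {h..<n}"

text \<open>
  \<open>fan_facets p q x h \<union> path_join p q x h n\<close> is the ball after the path from \<open>x 0\<close> to \<open>x h\<close> has been
  replaced by the chord \<open>{x 0, x h}\<close>.
\<close>

definition fan_facets :: "'a \<Rightarrow> 'a \<Rightarrow> (nat \<Rightarrow> 'a) \<Rightarrow> nat \<Rightarrow> 'a set set" where
  "fan_facets p q x h = insert {p, q, x 0, x h}
     ((\<lambda>c. {p, x 0, x c, x (Suc c)}) ` {1..<h} \<union> (\<lambda>c. {q, x 0, x c, x (Suc c)}) ` {1..<h})"

text \<open>For \<open>h = 1\<close> the chord is the first edge of the path and the fan is a single
  tetrahedron, so nothing has been replaced yet.\<close>

lemma path_join_eq_fan_facets: "n > 0 \<Longrightarrow> path_join p q x 0 n = fan_facets p q x 1 \<union> path_join p q x 1 n"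
proof -
  assume "n > 0"
  then have "{0..<n} = insert 0 {1..<n}" by auto
  then show ?thesis by (simp add: path_join_def fan_facets_def)
qed

text \<open>A flip of the two tetrahedra at the triangle \<open>{p, q, x h}\<close> into three
  around the edge \<open>{x 0, x (Suc h)}\<close>. \<open>R1\<close> keeps further facets away from
  the triangle, and \<open>R2\<close> ensures that the edge is new.\<close>

lemma fan_flip:
  assumes h: "1 \<le> h" "h < n" and inj: "inj_on x {..n}"
    and pq: "p \<noteq> q" "p \<notin> x ` {..n}" "q \<notin> x ` {..n}"
    and fin: "\<And>T. T \<in> R \<Longrightarrow> finite T"
    and R1: "\<And>T. T \<in> R \<Longrightarrow> \<not> {p, q, x h} \<subseteq> T"
    and R2: "\<And>T. T \<in> R \<Longrightarrow> \<not> {x 0, x (Suc h)} \<subseteq> T"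
  shows "geometric_realization (down_closure (R \<union> (fan_facets p q x h \<union> path_join p q x h n))) homeomorphic_space
    geometric_realization (down_closure (R \<union> (fan_facets p q x (Suc h) \<union> path_join p q x (Suc h) n)))"
proof (rule bistellar_flip[of "{p, q, x h}" "{x 0, x (Suc h)}"])
  let ?C = "{p, q, x h}" and ?A = "{x 0, x (Suc h)}"
  have x: "x i = x j \<longleftrightarrow> i = j" if "i \<le> n" "j \<le> n" for i j
    using inj_on_eq_iff[OF inj] that by auto
  have xp: "x i \<noteq> p" "p \<noteq> x i" "x i \<noteq> q" "q \<noteq> x i" if "i \<le> n" for i
    using pq that by auto
  show "?C \<inter> ?A = {}" using h by (auto simp: x xp)
  have split: "{h..<n} = insert h {Suc h..<n}" "{1..<Suc h} = insert h {1..<h}"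
    using h by auto
  let ?F = "fan_facets p q x h \<union> path_join p q x h n"
  show "finite T" if "T \<in> R \<union> ?F" for T
    using that fin by (auto simp: fan_facets_def path_join_def)
  show "\<not> ?A \<subseteq> T" if "T \<in> R \<union> ?F" for T
  proof (cases "T \<in> R")
    case True
    then show ?thesis by (rule R2)
  next
    case False
    with that show ?thesis
      using h by (auto simp: fan_facets_def path_join_def x xp)
  qed
  \<comment> \<open>The facets of the ball that the flip leaves alone.\<close>
  define rest where "rest = (\<lambda>c. {p, x 0, x c, x (Suc c)}) ` {1..<h} \<union> (\<lambda>c. {q, x 0, x c, x (Suc c)}) ` {1..<h}
    \<union> path_join p q x (Suc h) n"
  have F: "?F = {{p, q, x 0, x h}, {p, q, x h, x (Suc h)}} \<union> rest"
    unfolding fan_facets_def path_join_def split rest_def by auto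
  have F': "fan_facets p q x (Suc h) \<union> path_join p q x (Suc h) n =
      {{p, q, x 0, x (Suc h)}, {p, x 0, x h, x (Suc h)}, {q, x 0, x h, x (Suc h)}} \<union> rest"
    unfolding fan_facets_def path_join_def split rest_def by auto
  have rest: "\<not> ?C \<subseteq> T" if "T \<in> rest" for T
    using that h pq(1) by (auto simp: rest_def path_join_def x xp)
  show "T \<subseteq> ?A \<union> ?C" if "T \<in> R \<union> ?F" "?C \<subseteq> T" for T
  proof -
    have "T \<notin> R" "T \<notin> rest" using that(2) R1 rest by blast+
    then have "T = {p, q, x 0, x h} \<or> T = {p, q, x h, x (Suc h)}"
      using that(1) unfolding F by blast
    then show ?thesis by blast
  qed
  have AC: "?A \<union> ?C - {x 0} = {p, q, x h, x (Suc h)}" "?A \<union> ?C - {x (Suc h)} = {p, q, x 0, x h}"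
    "?A \<union> ?C - {p} = {q, x 0, x h, x (Suc h)}" "?A \<union> ?C - {q} = {p, x 0, x h, x (Suc h)}"
    "?A \<union> ?C - {x h} = {p, q, x 0, x (Suc h)}"
    using h pq(1) by (auto simp: x xp)
  show "?A \<union> ?C - {a} \<in> R \<union> ?F" if "a \<in> ?A" for a
  proof -
    have "{p, q, x h, x (Suc h)} \<in> R \<union> ?F" "{p, q, x 0, x h} \<in> R \<union> ?F"
      unfolding F by blast+
    moreover have "a = x 0 \<or> a = x (Suc h)" using that by blast
    ultimately show ?thesis by (elim disjE) (simp_all only: AC)
  qed
  have "{T \<in> R \<union> ?F. \<not> ?C \<subseteq> T} = R \<union> rest"
    using R1 rest unfolding F by blast
  moreover have "(\<lambda>c. ?A \<union> ?C - {c}) ` ?C =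
      {{p, q, x 0, x (Suc h)}, {p, x 0, x h, x (Suc h)}, {q, x 0, x h, x (Suc h)}}"
    unfolding image_insert AC image_empty by blast
  ultimately show "R \<union> (fan_facets p q x (Suc h) \<union> path_join p q x (Suc h) n) =
      {T \<in> R \<union> ?F. \<not> ?C \<subseteq> T} \<union> (\<lambda>c. ?A \<union> ?C - {c}) ` ?C"
    unfolding F' by (simp only: Un_assoc Un_commute Un_left_commute)
qed auto

text \<open>The fan grows by \<open>n - 1\<close> flips; \<open>R1\<close> and \<open>R2\<close>
  cover the triangles removed and the edges introduced in all of them.\<close>

theorem path_join_to_fan:
  assumes n: "n > 0" and inj: "inj_on x {..n}"
    and pq: "p \<noteq> q" "p \<notin> x ` {..n}" "q \<notin> x ` {..n}"
    and fin: "\<And>T. T \<in> R \<Longrightarrow> finite T"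
    and R1: "\<And>T c. T \<in> R \<Longrightarrow> 0 < c \<Longrightarrow> c < n \<Longrightarrow> \<not> {p, q, x c} \<subseteq> T"
    and R2: "\<And>T c. T \<in> R \<Longrightarrow> 2 \<le> c \<Longrightarrow> c \<le> n \<Longrightarrow> \<not> {x 0, x c} \<subseteq> T"
  shows "geometric_realization (down_closure (R \<union> path_join p q x 0 n)) homeomorphic_space
    geometric_realization (down_closure (R \<union> fan_facets p q x n))"
proof -
  let ?G = "\<lambda>h. geometric_realization (down_closure (R \<union> (fan_facets p q x h \<union> path_join p q x h n)))"
  have "?G 1 homeomorphic_space ?G h" if "1 \<le> h" "h \<le> n" for h
    using that
  proof (induction h rule: nat_induct_at_least)
    case base
    show ?case by (rule homeomorphic_space_refl)
  next
    case (Suc h)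
    have "?G h homeomorphic_space ?G (Suc h)"
      using Suc.hyps Suc.prems by (intro fan_flip inj pq fin R1 R2) auto
    then show ?case
      using Suc.IH Suc.prems by (meson Suc_leD homeomorphic_space_trans)
  qed
  from this[of n] show ?thesis
    using n by (simp add: path_join_eq_fan_facets path_join_def[of p q x n n])
qed

section \<open>The cyclic complex\<close>

locale cyclic_sphere =
  fixes M :: int
  assumes M: "M \<ge> 2"
begin

text \<open>Integer arguments allow offsets such as \<open>i - 2\<close> without case distinctions;
  the vertices themselves are the numbers below \<open>4 * M\<close>.\<close>

definition v :: "int \<Rightarrow> nat" where
  "v x = nat (x mod (4 * M))"

definition strip :: "int \<Rightarrow> nat set" where
  "strip i = {v i, v (i + 1), v (i + 2), v (i + 3)}"

text \<open>The path runs from \<open>i + 1\<close> to \<open>i + 2 * M - 1\<close>, just short of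
  the antipode of \<open>i + 1\<close>. The \<open>4 * M\<close> balls have \<open>M - 1\<close>
  tetrahedra each; with the \<open>4 * M\<close> strips these make up all \<open>(2 * M)^2\<close>
  tetrahedra of the join.\<close>

definition ball :: "int \<Rightarrow> nat set set" where
  "ball i = path_join (v (i - 2)) (v i) (\<lambda>c. v (i + 1 + 2 * int c)) 0 (nat (M - 1))"

definition fan :: "int \<Rightarrow> nat set set" where
  "fan i = fan_facets (v (i - 2)) (v i) (\<lambda>c. v (i + 1 + 2 * int c)) (nat (M - 1))"

lemma v_eq_iff_dvd: "v x = v y \<longleftrightarrow> 4 * M dvd x - y"
  using M by (simp add: v_def eq_nat_nat_iff mod_eq_dvd_iff)

text \<open>The bounds leave only -1, 0 and 1 as quotients by \<open>4 * M\<close>. Coincidences of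
  vertices thereby become linear conditions that arithmetic procedures decide.\<close>

lemma v_eq_iff:
  assumes "x - y < 8 * M" "y - x < 8 * M"
  shows "v x = v y \<longleftrightarrow> x = y \<or> x = y + 4 * M \<or> x = y - 4 * M"
proof
  assume "v x = v y"
  then obtain k where k: "x - y = 4 * M * k" by (auto simp: v_eq_iff_dvd)
  have "M * k < M * 2" "M * (- 2) < M * k" using assms k by linarith+
  then have "k < 2" "- 2 < k" using M mult_less_cancel_left_pos[of M k 2] mult_less_cancel_left_pos[of M "- 2" k] by linarith+
  then consider "k = - 1" | "k = 0" | "k = 1" by linarith
  then show "x = y \<or> x = y + 4 * M \<or> x = y - 4 * M" using k by cases auto
qed (auto simp: v_eq_iff_dvd)

lemma v_parity: "even x \<noteq> even y \<Longrightarrow> v x \<noteq> v y"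
  unfolding v_eq_iff_dvd by (meson dvd_trans dvd_triv_left even_diff even_mult_iff even_numeral dvd_mult2 even_add)

text \<open>
  The ten lemmas below exclude the interior faces and the new edges of the \<open>i\<close>-th ball from all other
  facets. Matching parities leaves few coincidences of vertices, and those are refuted by the bounds
  on the representatives.
\<close>

lemma strip_link:
  assumes "0 < c" "c < M - 1" "0 \<le> i" "i < 4 * M" "0 \<le> j" "j < 4 * M"
  shows "\<not> {v (i - 2), v i, v (i + 1 + 2 * c)} \<subseteq> strip j"
  using assms M by (cases "even i \<longleftrightarrow> even j")
    (simp_all add: strip_def v_parity v_eq_iff, arith+)

lemma ball_link:
  assumes "0 < c" "c < M - 1" "i \<noteq> j" "0 \<le> d" "d < M - 1" "0 \<le> i" "i < 4 * M" "0 \<le> j" "j < 4 * M"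
  shows "\<not> {v (i - 2), v i, v (i + 1 + 2 * c)} \<subseteq> {v (j - 2), v j, v (j + 1 + 2 * d), v (j + 3 + 2 * d)}"
  using assms M by (cases "even i \<longleftrightarrow> even j")
    (simp_all add: strip_def v_parity v_eq_iff, arith+)

lemma base_link:
  assumes "0 < c" "c < M - 1" "i \<noteq> j" "0 \<le> i" "i < 4 * M" "0 \<le> j" "j < 4 * M"
  shows "\<not> {v (i - 2), v i, v (i + 1 + 2 * c)} \<subseteq> {v (j - 2), v j, v (j + 1), v (j + 1 + 2 * (M - 1))}"
  using assms M by (cases "even i \<longleftrightarrow> even j")
    (simp_all add: strip_def v_parity v_eq_iff, arith+)

lemma fan1_link:
  assumes "0 < c" "c < M - 1" "i \<noteq> j" "0 < d" "d < M - 1" "0 \<le> i" "i < 4 * M" "0 \<le> j" "j < 4 * M"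
  shows "\<not> {v (i - 2), v i, v (i + 1 + 2 * c)} \<subseteq> {v (j - 2), v (j + 1), v (j + 1 + 2 * d), v (j + 3 + 2 * d)}"
  using assms M by (cases "even i \<longleftrightarrow> even j")
    (simp_all add: strip_def v_parity v_eq_iff, arith+)

lemma fan2_link:
  assumes "0 < c" "c < M - 1" "i \<noteq> j" "0 < d" "d < M - 1" "0 \<le> i" "i < 4 * M" "0 \<le> j" "j < 4 * M"
  shows "\<not> {v (i - 2), v i, v (i + 1 + 2 * c)} \<subseteq> {v j, v (j + 1), v (j + 1 + 2 * d), v (j + 3 + 2 * d)}"
  using assms M by (cases "even i \<longleftrightarrow> even j")
    (simp_all add: strip_def v_parity v_eq_iff, arith+)

lemma strip_edge:
  assumes "2 \<le> c" "c \<le> M - 1" "0 \<le> i" "i < 4 * M" "0 \<le> j" "j < 4 * M"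
  shows "\<not> {v (i + 1), v (i + 1 + 2 * c)} \<subseteq> strip j"
  using assms M by (cases "even i \<longleftrightarrow> even j")
    (simp_all add: strip_def v_parity v_eq_iff, arith+)

lemma ball_edge:
  assumes "2 \<le> c" "c \<le> M - 1" "i \<noteq> j" "0 \<le> d" "d < M - 1" "0 \<le> i" "i < 4 * M" "0 \<le> j" "j < 4 * M"
  shows "\<not> {v (i + 1), v (i + 1 + 2 * c)} \<subseteq> {v (j - 2), v j, v (j + 1 + 2 * d), v (j + 3 + 2 * d)}"
  using assms M by (cases "even i \<longleftrightarrow> even j")
    (simp_all add: strip_def v_parity v_eq_iff, arith+)

lemma base_edge:
  assumes "2 \<le> c" "c \<le> M - 1" "i \<noteq> j" "0 \<le> i" "i < 4 * M" "0 \<le> j" "j < 4 * M"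
  shows "\<not> {v (i + 1), v (i + 1 + 2 * c)} \<subseteq> {v (j - 2), v j, v (j + 1), v (j + 1 + 2 * (M - 1))}"
  using assms M by (cases "even i \<longleftrightarrow> even j")
    (simp_all add: strip_def v_parity v_eq_iff, arith+)

lemma fan1_edge:
  assumes "2 \<le> c" "c \<le> M - 1" "i \<noteq> j" "0 < d" "d < M - 1" "0 \<le> i" "i < 4 * M" "0 \<le> j" "j < 4 * M"
  shows "\<not> {v (i + 1), v (i + 1 + 2 * c)} \<subseteq> {v (j - 2), v (j + 1), v (j + 1 + 2 * d), v (j + 3 + 2 * d)}"
  using assms M by (cases "even i \<longleftrightarrow> even j")
    (simp_all add: strip_def v_parity v_eq_iff, arith+)

lemma fan2_edge:
  assumes "2 \<le> c" "c \<le> M - 1" "i \<noteq> j" "0 < d" "d < M - 1" "0 \<le> i" "i < 4 * M" "0 \<le> j" "j < 4 * M"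
  shows "\<not> {v (i + 1), v (i + 1 + 2 * c)} \<subseteq> {v j, v (j + 1), v (j + 1 + 2 * d), v (j + 3 + 2 * d)}"
  using assms M by (cases "even i \<longleftrightarrow> even j")
    (simp_all add: strip_def v_parity v_eq_iff, arith+)


text \<open>The integer index \<open>d\<close> replaces the natural number of
  \<open>path_join\<close>, matching the exclusion lemmas above.\<close>

lemma mem_ball:
  "T \<in> ball i \<longleftrightarrow> (\<exists>d. 0 \<le> d \<and> d < M - 1 \<and> T = {v (i - 2), v i, v (i + 1 + 2 * d), v (i + 3 + 2 * d)})"
proof
  assume "T \<in> ball i"
  then obtain c where "c < nat (M - 1)" "T = {v (i - 2), v i, v (i + 1 + 2 * int c), v (i + 1 + 2 * int (Suc c))}"
    by (auto simp: ball_def path_join_def)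
  then show "\<exists>d. 0 \<le> d \<and> d < M - 1 \<and> T = {v (i - 2), v i, v (i + 1 + 2 * d), v (i + 3 + 2 * d)}"
    by (intro exI[of _ "int c"]) (auto simp: algebra_simps)
next
  assume "\<exists>d. 0 \<le> d \<and> d < M - 1 \<and> T = {v (i - 2), v i, v (i + 1 + 2 * d), v (i + 3 + 2 * d)}"
  then obtain d where d: "0 \<le> d" "d < M - 1" "T = {v (i - 2), v i, v (i + 1 + 2 * d), v (i + 3 + 2 * d)}" by blast
  then have "nat d \<in> {0..<nat (M - 1)}" "T = {v (i - 2), v i, v (i + 1 + 2 * int (nat d)), v (i + 1 + 2 * int (Suc (nat d)))}"
    by (auto simp: algebra_simps)
  then show "T \<in> ball i" unfolding ball_def path_join_def by blast
qed

lemma mem_fan: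
  "T \<in> fan i \<longleftrightarrow> T = {v (i - 2), v i, v (i + 1), v (i + 1 + 2 * (M - 1))} \<or>
     (\<exists>d. 0 < d \<and> d < M - 1 \<and> (T = {v (i - 2), v (i + 1), v (i + 1 + 2 * d), v (i + 3 + 2 * d)} \<or>
       T = {v i, v (i + 1), v (i + 1 + 2 * d), v (i + 3 + 2 * d)}))" (is "_ \<longleftrightarrow> ?base \<or> (\<exists>d. ?R d)")
proof -
  define N where "N = nat (M - 1)"
  have fan: "fan i = insert {v (i - 2), v i, v (i + 1), v (i + 1 + 2 * (M - 1))}
      ((\<lambda>c. {v (i - 2), v (i + 1), v (i + 1 + 2 * int c), v (i + 3 + 2 * int c)}) ` {1..<N} \<union>
       (\<lambda>c. {v i, v (i + 1), v (i + 1 + 2 * int c), v (i + 3 + 2 * int c)}) ` {1..<N})"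
    using M by (simp add: fan_def fan_facets_def N_def algebra_simps)
  show ?thesis
  proof
    assume "T \<in> fan i"
    then consider ?base | c where "c \<in> {1..<N}" "?R (int c)"
      unfolding fan N_def by auto
    then show "?base \<or> (\<exists>d. ?R d)" by cases blast+
  next
    assume "?base \<or> (\<exists>d. ?R d)"
    then show "T \<in> fan i"
    proof (elim disjE exE)
      fix d assume d: "?R d"
      then have "nat d \<in> {1..<N}" "int (nat d) = d" by (auto simp: N_def)
      then show ?thesis using d unfolding fan by (metis (no_types, lifting) UnCI image_eqI insertI2)
    qed (simp add: fan)
  qed
qed

lemma finite_facet: "T \<in> range strip \<union> ball i \<union> fan i \<Longrightarrow> finite T"
  by (auto simp: strip_def mem_ball mem_fan)

text \<open>Together with \<open>facet_edge\<close> this provides \<open>R1\<close> and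
  \<open>R2\<close> of \<open>path_join_to_fan\<close> for the ball at \<open>i\<close>. Both
  \<open>ball j\<close> and \<open>fan j\<close> occur because some balls are already retriangulated
  and others still intact.\<close>

lemma facet_link:
  assumes "0 < c" "c < M - 1" "0 \<le> i" "i < 4 * M" "0 \<le> j" "j < 4 * M"
    and "T = strip j \<or> i \<noteq> j \<and> T \<in> ball j \<union> fan j"
  shows "\<not> {v (i - 2), v i, v (i + 1 + 2 * c)} \<subseteq> T"
  using assms(7) strip_link[OF assms(1-6)] ball_link[OF assms(1,2) _ _ _ assms(3-6)]
    base_link[OF assms(1,2) _ assms(3-6)] fan1_link[OF assms(1,2) _ _ _ assms(3-6)]
    fan2_link[OF assms(1,2) _ _ _ assms(3-6)]
  unfolding Un_iff mem_ball mem_fan by metis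

lemma facet_edge:
  assumes "2 \<le> c" "c \<le> M - 1" "0 \<le> i" "i < 4 * M" "0 \<le> j" "j < 4 * M"
    and "T = strip j \<or> i \<noteq> j \<and> T \<in> ball j \<union> fan j"
  shows "\<not> {v (i + 1), v (i + 1 + 2 * c)} \<subseteq> T"
  using assms(7) strip_edge[OF assms(1-6)] ball_edge[OF assms(1,2) _ _ _ assms(3-6)]
    base_edge[OF assms(1,2) _ assms(3-6)] fan1_edge[OF assms(1,2) _ _ _ assms(3-6)]
    fan2_edge[OF assms(1,2) _ _ _ assms(3-6)]
  unfolding Un_iff mem_ball mem_fan by metis

section \<open>Replacing the balls one at a time\<close>

lemma v_periodic: "v (x + 4 * M * k) = v x"
  by (simp add: v_def)

lemma v_mod: "v (i mod (4 * M) + a) = v (i + a)"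
  by (simp add: v_def mod_add_left_eq)

lemma v_mod_0: "v (i mod (4 * M)) = v i" and v_mod_diff: "v (i mod (4 * M) - a) = v (i - a)"
  by (simp_all add: v_def mod_diff_left_eq)

lemma strip_mod: "strip (i mod (4 * M)) = strip i"
  by (simp add: strip_def v_mod v_mod_0)

lemma ball_mod: "ball (i mod (4 * M)) = ball i"
  by (simp add: ball_def v_mod v_mod_0 v_mod_diff add.assoc)

lemma fan_mod: "fan (i mod (4 * M)) = fan i"
  by (simp add: fan_def v_mod v_mod_0 v_mod_diff add.assoc)

text \<open>At \<open>k = 0\<close> this is the join of the even and the odd cycle, at
  \<open>k = 4 * M\<close> the final complex.\<close>

definition stage :: "int \<Rightarrow> nat set set" where
  "stage k = range strip \<union> (\<Union>i\<in>{k..<4 * M}. ball i) \<union> (\<Union>i\<in>{0..<k}. fan i)"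

lemma stage_step:
  assumes k: "0 \<le> k" "k < 4 * M"
  shows "geometric_realization (down_closure (stage k)) homeomorphic_space
    geometric_realization (down_closure (stage (k + 1)))"
proof -
  define R where "R = range strip \<union> (\<Union>i\<in>{k + 1..<4 * M}. ball i) \<union> (\<Union>i\<in>{0..<k}. fan i)"
  have "{k..<4 * M} = insert k {k + 1..<4 * M}" "{0..<k + 1} = insert k {0..<k}" using k by auto
  then have stage: "stage k = R \<union> ball k" "stage (k + 1) = R \<union> fan k"
    by (auto simp: stage_def R_def)
  have R: "\<exists>j. 0 \<le> j \<and> j < 4 * M \<and> (T = strip j \<or> k \<noteq> j \<and> T \<in> ball j \<union> fan j)" if "T \<in> R" for T
  proof -
    from that consider i where "T = strip i" | j where "k + 1 \<le> j" "j < 4 * M" "T \<in> ball j"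
      | j where "0 \<le> j" "j < k" "T \<in> fan j"
      unfolding R_def by auto
    then show ?thesis
    proof cases
      case (1 i)
      \<comment> \<open>The exclusion lemmas expect an index in \<open>{0..<4 * M}\<close>; reducing
        it leaves the strip unchanged.\<close>
      then show ?thesis using M strip_mod[of i] by (intro exI[of _ "i mod (4 * M)"]) simp
    next
      case (2 j)
      then show ?thesis using k by (intro exI[of _ j]) auto
    next
      case (3 j)
      then show ?thesis using k by (intro exI[of _ j]) auto
    qed
  qed
  let ?x = "\<lambda>c. v (k + 1 + 2 * int c)"
  show ?thesis
    unfolding stage ball_def fan_def
  proof (rule path_join_to_fan)
    show "nat (M - 1) > 0" using M by simp
    show "inj_on ?x {..nat (M - 1)}" using M by (intro inj_onI) (auto simp: v_eq_iff)
    show "v (k - 2) \<noteq> v k" using M by (simp add: v_eq_iff)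
    show "v (k - 2) \<notin> ?x ` {..nat (M - 1)}" "v k \<notin> ?x ` {..nat (M - 1)}"
      by (auto simp: v_parity)
    show "finite T" if "T \<in> R" for T
      using R[OF that] finite_facet by blast
    show "\<not> {v (k - 2), v k, ?x c} \<subseteq> T" if "T \<in> R" "0 < c" "c < nat (M - 1)" for T c
      using R[OF that(1)] facet_link[of "int c" k] that k by fastforce
    show "\<not> {?x 0, ?x c} \<subseteq> T" if "T \<in> R" "2 \<le> c" "c \<le> nat (M - 1)" for T c
      using R[OF that(1)] facet_edge[of "int c" k] that k by fastforce
  qed
qed

lemma stage_0_to_end:
  "geometric_realization (down_closure (stage 0)) homeomorphic_space
    geometric_realization (down_closure (stage (4 * M)))"
proof -
  have "geometric_realization (down_closure (stage 0)) homeomorphic_space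
      geometric_realization (down_closure (stage k))" if "0 \<le> k" "k \<le> 4 * M" for k
    using that
  proof (induction k rule: int_ge_induct)
    case base
    show ?case by (rule homeomorphic_space_refl)
  next
    case (step k)
    then show ?case using stage_step[of k] homeomorphic_space_trans by fastforce
  qed
  then show ?thesis using M by simp
qed

end

section \<open>The initial stage as a join of two cycles\<close>

lemma join_facets_range: "join_facets (range f) (range g) = {f a \<union> g b | a b. True}"
  unfolding join_facets_def by blast

context cyclic_sphere
begin

text \<open>Indexing by all integers absorbs the closing edge by periodicity; \<open>e\<close> is 0
  for the even cycle and 1 for the odd one.\<close>

lemma cycle_edges_v:
  "cycle_edges (\<lambda>k. v (2 * int k + e)) (nat (2 * M)) = range (\<lambda>a. {v (2 * a + e), v (2 * a + 2 + e)})"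
  (is "?L = ?R")
proof (intro equalityI subsetI)
  have last: "int (nat (2 * M) - 1) = 2 * M - 1" using M by simp
  have wrap: "v e = v (2 * (2 * M - 1) + 2 + e)"
    using v_periodic[of e 1] by (simp add: algebra_simps)
  fix s
  {
    assume "s \<in> ?L"
    then consider k where "s = {v (2 * int k + e), v (2 * int (Suc k) + e)}"
      | "s = {v (2 * int (nat (2 * M) - 1) + e), v (2 * int 0 + e)}"
      unfolding cycle_edges_def by blast
    then show "s \<in> ?R"
    proof cases
      case (1 k)
      then show ?thesis by (intro range_eqI[of _ _ "int k"]) (simp add: algebra_simps)
    next
      case 2
      then show ?thesis using wrap unfolding last by (intro range_eqI[of _ _ "2 * M - 1"]) simp
    qed
  next
    assume "s \<in> ?R"
    then obtain a where s: "s = {v (2 * a + e), v (2 * a + 2 + e)}" by blast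
    \<comment> \<open>Reducing \<open>a\<close> modulo \<open>2 * M\<close> changes
      \<open>2 * a\<close> by a multiple of \<open>4 * M\<close>, hence changes no vertex.\<close>
    define b where "b = a mod (2 * M)"
    have b: "0 \<le> b" "b < 2 * M" using M by (auto simp: b_def)
    have "a = b + 2 * M * (a div (2 * M))" by (simp add: b_def)
    then have "2 * a + t = (2 * b + t) + 4 * M * (a div (2 * M))" for t
      by (simp add: algebra_simps)
    then have v: "v (2 * a + t) = v (2 * b + t)" for t using v_periodic by metis
    have s: "s = {v (2 * b + e), v (2 * b + 2 + e)}"
      unfolding s using v[of e] v[of "2 + e"] by (simp add: add.assoc)
    show "s \<in> ?L"
    proof (cases "b = 2 * M - 1")
      case True
      then have "s = {v (2 * int (nat (2 * M) - 1) + e), v (2 * int 0 + e)}"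
        unfolding last s using wrap by simp
      then show ?thesis unfolding cycle_edges_def by blast
    next
      case False
      then have "Suc (nat b) < nat (2 * M)" using b by linarith
      moreover have "s = {v (2 * int (nat b) + e), v (2 * int (Suc (nat b)) + e)}"
        using b s by (simp add: algebra_simps)
      ultimately show ?thesis unfolding cycle_edges_def by blast
    qed
  }
qed

lemma Union_ball: "(\<Union>i\<in>{0..<4 * M}. ball i) = (\<Union>i. ball i)"
proof -
  have "ball i \<subseteq> (\<Union>i\<in>{0..<4 * M}. ball i)" for i
    using M ball_mod[of i] by (intro order_trans[OF _ UN_upper[of "i mod (4 * M)"]]) auto
  then show ?thesis by blast
qed

lemma Union_fan: "(\<Union>i\<in>{0..<4 * M}. fan i) = (\<Union>i. fan i)"
proof -
  have "fan i \<subseteq> (\<Union>i\<in>{0..<4 * M}. fan i)" for i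
    using M fan_mod[of i] by (intro order_trans[OF _ UN_upper[of "i mod (4 * M)"]]) auto
  then show ?thesis by blast
qed

text \<open>The place of the tetrahedron on the even edge at \<open>2 * a\<close> and the odd edge
  at \<open>2 * b + 1\<close> is determined by \<open>b - a\<close> modulo \<open>2 * M\<close>: the
  residues 0 and \<open>2 * M - 1\<close> give strips, those up to \<open>M - 1\<close> balls of
  even index, the others balls of odd index.\<close>

lemma stage_0:
  "stage 0 = join_facets (range (\<lambda>a. {v (2 * a + 0), v (2 * a + 2 + 0)}))
                         (range (\<lambda>a. {v (2 * a + 1), v (2 * a + 2 + 1)}))" (is "_ = ?J")
proof -
  have J: "?J = {{v (2 * a), v (2 * a + 2), v (2 * b + 1), v (2 * b + 3)} | a b. True}"
  proof -
    have "{v (2 * a + 0), v (2 * a + 2 + 0)} \<union> {v (2 * b + 1), v (2 * b + 2 + 1)}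
      = {v (2 * a), v (2 * a + 2), v (2 * b + 1), v (2 * b + 3)}" for a b
      by (auto simp: add.assoc)
    then show ?thesis by (simp only: join_facets_range)
  qed
  have "stage 0 \<subseteq> ?J"
  proof
    fix T assume "T \<in> stage 0"
    then consider i where "T = strip i"
      | i d where "T = {v (i - 2), v i, v (i + 1 + 2 * d), v (i + 3 + 2 * d)}"
      unfolding stage_def by (auto simp: mem_ball)
    then show "T \<in> ?J"
    proof cases
      case (1 i)
      show ?thesis
      proof (cases "even i")
        case True
        then obtain a where "i = 2 * a" by blast
        then have "T = {v (2 * a), v (2 * a + 2), v (2 * a + 1), v (2 * a + 3)}"
          using 1 by (auto simp: strip_def)
        then show ?thesis unfolding J by blast
      next
        case False
        then obtain a where "i = 2 * a + 1" using oddE by blast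
        then have "T = {v (2 * (a + 1)), v (2 * (a + 1) + 2), v (2 * a + 1), v (2 * a + 3)}"
          using 1 by (auto simp: strip_def algebra_simps)
        then show ?thesis unfolding J by blast
      qed
    next
      case (2 i d)
      show ?thesis
      proof (cases "even i")
        case True
        then obtain a where "i = 2 * a" by blast
        then have "T = {v (2 * (a - 1)), v (2 * (a - 1) + 2), v (2 * (a + d) + 1), v (2 * (a + d) + 3)}"
          using 2 by (auto simp: algebra_simps)
        then show ?thesis unfolding J by blast
      next
        case False
        then obtain a where "i = 2 * a + 1" using oddE by blast
        then have "T = {v (2 * (a + 1 + d)), v (2 * (a + 1 + d) + 2), v (2 * (a - 1) + 1), v (2 * (a - 1) + 3)}"
          using 2 by (auto simp: algebra_simps)
        then show ?thesis unfolding J by blast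
      qed
    qed
  qed
  moreover have "?J \<subseteq> stage 0"
  proof
    fix T assume "T \<in> ?J"
    then obtain a b where T: "T = {v (2 * a), v (2 * a + 2), v (2 * b + 1), v (2 * b + 3)}"
      unfolding J by blast
    define r where "r = (b - a) mod (2 * M)"
    have r: "0 \<le> r" "r < 2 * M" using M by (auto simp: r_def)
    have "b - a = r + 2 * M * ((b - a) div (2 * M))" by (simp add: r_def)
    then have "2 * b + t = (2 * a + 2 * r + t) + 4 * M * ((b - a) div (2 * M))" for t
      by (simp add: algebra_simps)
    then have v: "v (2 * b + t) = v (2 * a + 2 * r + t)" for t using v_periodic by metis
    have T: "T = {v (2 * a), v (2 * a + 2), v (2 * a + 2 * r + 1), v (2 * a + 2 * r + 3)}"
      unfolding T v ..
    have period: "v (x + 4 * M) = v x" for x using v_periodic[of x 1] by simp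
    consider "r = 0" | "r = 2 * M - 1" | "1 \<le> r" "r \<le> M - 1" | "M \<le> r" "r \<le> 2 * M - 2"
      using r by linarith
    then have "T \<in> range strip \<union> (\<Union>i. ball i)"
    proof cases
      case 1
      then have "T = strip (2 * a)" using T by (auto simp: strip_def)
      then show ?thesis by blast
    next
      case 2
      then have "2 * a + 2 * r + 1 = 2 * a - 1 + 4 * M" "2 * a + 2 * r + 3 = 2 * a + 1 + 4 * M"
        by linarith+
      then have "v (2 * a + 2 * r + 1) = v (2 * a - 1)" "v (2 * a + 2 * r + 3) = v (2 * a + 1)"
        by (simp_all only: period)
      then have "T = strip (2 * a - 1)" using T by (auto simp: strip_def algebra_simps)
      then show ?thesis by blast
    next
      \<comment> \<open>The even edge is the edge factor of the ball, and the odd edge lies on its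
        path.\<close>
      case 3
      then have "T \<in> ball (2 * a + 2)"
        unfolding mem_ball T by (intro exI[of _ "r - 1"]) (auto simp: algebra_simps)
      then show ?thesis by blast
    next
      \<comment> \<open>The roles are exchanged. Seen from the odd edge, the even edge is met after
        one turn, at \<open>2 * a + 4 * M\<close>, which determines the witness for
        \<open>d\<close>.\<close>
      case 4
      have "v (2 * a) = v (2 * a + 4 * M)" "v (2 * a + 2) = v (2 * a + 2 + 4 * M)"
        using period by simp_all
      with 4 have "T \<in> ball (2 * a + 2 * r + 3)"
        unfolding mem_ball T by (intro exI[of _ "2 * M - r - 2"]) (auto simp: algebra_simps)
      then show ?thesis by blast
    qed
    then show "T \<in> stage 0" by (simp add: stage_def Union_ball)
  qed
  ultimately show ?thesis by blast
qed

section \<open>The final complex and its rotations\<close>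

definition facets :: "nat set set" where
  "facets = range strip \<union> (\<Union>i. fan i)"

definition K :: "nat set set" where
  "K = down_closure facets"

lemma K_sphere: "geometric_realization K homeomorphic_space nsphere 3"
proof -
  have "stage (4 * M) = facets" by (simp add: stage_def facets_def Union_fan)
  moreover have "geometric_realization (down_closure (stage 0)) homeomorphic_space nsphere 3"
    unfolding stage_0 cycle_edges_v[symmetric]
  proof (rule cycle_join_sphere)
    show "nat (2 * M) \<ge> 3" using M by linarith
    show "inj_on (\<lambda>k. v (2 * int k + 0)) {..<nat (2 * M)}"
      "inj_on (\<lambda>k. v (2 * int k + 1)) {..<nat (2 * M)}"
      using M by (auto intro!: inj_onI simp: v_eq_iff)
    show "(\<lambda>k. v (2 * int k + 0)) ` {..<nat (2 * M)} \<inter> (\<lambda>k. v (2 * int k + 1)) ` {..<nat (2 * M)} = {}"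
      by (auto simp: v_parity)
  qed (use M in linarith)
  ultimately show ?thesis
    using stage_0_to_end unfolding K_def by (metis homeomorphic_space_sym homeomorphic_space_trans)
qed

lemma v_less: "v x < nat (4 * M)"
  using M by (simp add: v_def)

lemma v_of_nat: "u < nat (4 * M) \<Longrightarrow> v (int u) = u"
  by (simp add: v_def)

lemma K_subset: "K \<subseteq> Pow {..<nat (4 * M)}"
proof -
  have "T \<subseteq> {..<nat (4 * M)}" if "T \<in> facets" for T
    using that v_less by (auto simp: facets_def strip_def mem_fan)
  then show ?thesis by (auto simp: K_def down_closure_def)
qed

lemma finite_complex_K: "finite_simplicial_complex K"
proof -
  note sub = K_subset
  then have "finite K" by (rule finite_subset) simp
  moreover have "finite s" if "s \<in> K" for s
    using sub that by (auto intro: finite_subset)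
  ultimately show ?thesis
    unfolding finite_simplicial_complex_def by (auto simp: K_def down_closure_def)
qed

lemma vertices_K: "vertices K = {..<nat (4 * M)}"
proof
  show "vertices K \<subseteq> {..<nat (4 * M)}"
    using K_subset by (auto simp: vertices_def)
  show "{..<nat (4 * M)} \<subseteq> vertices K"
  proof
    fix u assume "u \<in> {..<nat (4 * M)}"
    then have "u \<in> strip (int u)" by (simp add: strip_def v_of_nat)
    moreover have "strip (int u) \<in> K" by (auto simp: K_def down_closure_def facets_def)
    ultimately show "u \<in> vertices K" by (auto simp: vertices_def)
  qed
qed

definition rot :: "int \<Rightarrow> nat \<Rightarrow> nat" where
  "rot t u = v (int u + t)"

lemma rot_v: "rot t (v x) = v (x + t)"
  using M by (simp add: rot_def v_def mod_add_left_eq)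

lemma rot_strip: "rot t ` strip i = strip (i + t)"
  by (simp add: strip_def rot_v algebra_simps)

lemma rot_fan: "(\<lambda>s. rot t ` s) ` fan i = fan (i + t)"
  by (simp add: fan_def fan_facets_def rot_v image_Un image_image algebra_simps)

text \<open>Strips and fans are indexed by all integers with one formula for both parities, so a
  rotation only shifts the index.\<close>

lemma rot_facets: "(\<lambda>s. rot t ` s) ` facets = facets"
proof -
  have shift: "range (\<lambda>i. f (i + t)) = range f" for f :: "int \<Rightarrow> 'b"
  proof -
    have "f i = f ((i - t) + t)" for i by simp
    then show ?thesis by blast
  qed
  then have "range (\<lambda>i. strip (i + t)) = range strip" "(\<Union>i. fan (i + t)) = (\<Union>i. fan i)"
    using shift[of strip] shift[of fan] by simp_all
  then show ?thesis
    by (simp add: facets_def image_Un image_UN image_image rot_strip rot_fan)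
qed

lemma rot_K: "(\<lambda>s. rot t ` s) ` K = K"
proof -
  have "(\<lambda>s. f ` s) ` down_closure F = down_closure ((\<lambda>s. f ` s) ` F)" for f :: "nat \<Rightarrow> nat" and F
    unfolding down_closure_def by (auto simp: subset_image_iff)
  then show ?thesis by (simp add: K_def rot_facets)
qed

lemma rot_rot: "u \<in> vertices K \<Longrightarrow> rot s (rot t u) = v (int u + t + s)"
  by (simp add: rot_def[of t] rot_v)

lemma bij_rot: "bij_betw (rot t) (vertices K) (vertices K)"
proof (rule bij_betwI[of _ _ _ "rot (- t)"])
  show "rot t \<in> vertices K \<rightarrow> vertices K" "rot (- t) \<in> vertices K \<rightarrow> vertices K"
    by (simp_all add: vertices_K rot_def v_less)
qed (simp_all add: rot_rot vertices_K v_of_nat)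

section \<open>Antipodal pairs and edges\<close>

lemma no_antipodal_face:
  assumes "s \<in> K"
  shows "\<not> {v x, v (x + 2 * M)} \<subseteq> s"
proof
  assume sub: "{v x, v (x + 2 * M)} \<subseteq> s"
  obtain T where T: "T \<in> facets" "s \<subseteq> T" using assms by (auto simp: K_def down_closure_def)
  \<comment> \<open>\<open>S\<close> collects offsets from a base index \<open>i\<close>. If
    \<open>a\<close> and \<open>b\<close> differ in parity, \<open>a + 2 * M - b\<close> is odd;
    otherwise they differ by less than \<open>2 * M\<close>, and it lies strictly between 0 and
    \<open>4 * M\<close>.\<close>
  have "\<exists>i S. T = (\<lambda>a. v (i + a)) ` S \<and> (\<forall>a\<in>S. \<forall>b\<in>S. \<not> 4 * M dvd a + 2 * M - b)"
  proof -
    have odd: "\<not> 4 * M dvd z" if "odd z" for z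
      using that dvd_trans[of 2 "4 * M" z] by auto
    from T(1) consider i where "T = strip i"
      | i where "T = {v (i - 2), v i, v (i + 1), v (i + 1 + 2 * (M - 1))}"
      | i d where "0 < d" "d < M - 1" "T = {v (i - 2), v (i + 1), v (i + 1 + 2 * d), v (i + 3 + 2 * d)}"
      | i d where "0 < d" "d < M - 1" "T = {v i, v (i + 1), v (i + 1 + 2 * d), v (i + 3 + 2 * d)}"
      unfolding facets_def UN_iff Un_iff mem_fan by blast
    then show ?thesis
    proof cases
      case (1 i)
      then show ?thesis using M
        by (intro exI[of _ i] exI[of _ "{0, 1, 2, 3}"]) (auto simp: strip_def dest!: zdvd_imp_le)
    next
      case (2 i)
      then show ?thesis using M
        by (intro exI[of _ i] exI[of _ "{-2, 0, 1, 1 + 2 * (M - 1)}"])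
          (auto simp: add.assoc odd dest!: zdvd_imp_le)
    next
      case (3 i d)
      then show ?thesis using M
        by (intro exI[of _ i] exI[of _ "{-2, 1, 1 + 2 * d, 3 + 2 * d}"]) (auto simp: add.assoc odd dest!: zdvd_imp_le)
    next
      case (4 i d)
      then show ?thesis using M
        by (intro exI[of _ i] exI[of _ "{0, 1, 1 + 2 * d, 3 + 2 * d}"]) (auto simp: add.assoc odd dest!: zdvd_imp_le)
    qed
  qed
  then obtain i S where S: "T = (\<lambda>a. v (i + a)) ` S" "\<forall>a\<in>S. \<forall>b\<in>S. \<not> 4 * M dvd a + 2 * M - b" by blast
  then obtain a b where ab: "a \<in> S" "b \<in> S" "v x = v (i + a)" "v (x + 2 * M) = v (i + b)"
    using sub T by blast
  then have "4 * M dvd x + 2 * M - (i + b)" "4 * M dvd x - (i + a)"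
    by (simp_all only: v_eq_iff_dvd)
  then have "4 * M dvd (x + 2 * M - (i + b)) - (x - (i + a))"
    by (rule dvd_diff)
  moreover have "(x + 2 * M - (i + b)) - (x - (i + a)) = a + 2 * M - b" by simp
  ultimately show False using S ab by metis
qed

text \<open>These triangles yield edges of both kinds: \<open>{v i, v (i + 1 + 2 * c)}\<close> with
  odd difference and \<open>{v (i + 1), v (i + 1 + 2 * c)}\<close> with even difference.\<close>

lemma fan_edges:
  assumes "1 \<le> c" "c \<le> M - 1"
  shows "{v i, v (i + 1), v (i + 1 + 2 * c)} \<in> K"
proof -
  have "\<exists>T\<in>fan i. {v i, v (i + 1), v (i + 1 + 2 * c)} \<subseteq> T"
  proof (cases "c = M - 1")
    case True
    then show ?thesis unfolding Bex_def mem_fan by blast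
  next
    case False
    then have "{v i, v (i + 1), v (i + 1 + 2 * c), v (i + 3 + 2 * c)} \<in> fan i"
      unfolding mem_fan using assms by (intro disjI2 exI[of _ c]) simp
    then show ?thesis by (rule bexI[rotated]) simp
  qed
  then show ?thesis by (auto simp: K_def down_closure_def facets_def)
qed

lemma K_closed: "s \<in> K \<Longrightarrow> t \<subseteq> s \<Longrightarrow> t \<in> K"
  unfolding K_def down_closure_def by blast

lemma edge_short:
  assumes "0 < d" "d < 2 * M"
  shows "{v x, v (x + d)} \<in> K"
proof -
  have strip: "strip x \<in> K" by (auto simp: K_def down_closure_def facets_def)
  consider "d = 1 \<or> d = 2" | c where "d = 1 + 2 * c" "1 \<le> c" "c \<le> M - 1" | c where "d = 2 * c" "1 \<le> c" "c \<le> M - 1"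
  proof -
    have "d = 2 * (d div 2) \<or> d = 1 + 2 * (d div 2)" by presburger
    then show ?thesis using that assms by (smt (verit))
  qed
  then show ?thesis
  proof cases
    case 1
    then show ?thesis by (intro K_closed[OF strip]) (auto simp: strip_def)
  next
    case (2 c)
    then show ?thesis by (intro K_closed[OF fan_edges[of c x]]) (auto simp: algebra_simps)
  next
    \<comment> \<open>With index \<open>x - 1\<close> the chord starts at
      \<open>v x\<close>.\<close>
    case (3 c)
    then show ?thesis by (intro K_closed[OF fan_edges[of c "x - 1"]]) (auto simp: algebra_simps)
  qed
qed

lemma edge:
  assumes "v x \<noteq> v y" "v y \<noteq> v (x + 2 * M)"
  shows "{v x, v y} \<in> K"
proof -
  define d where "d = (y - x) mod (4 * M)"
  have d: "0 \<le> d" "d < 4 * M" using M by (auto simp: d_def)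
  have "y = x + d + 4 * M * ((y - x) div (4 * M))" by (simp add: d_def)
  then have y: "v y = v (x + d)" using v_periodic by metis
  have "d \<noteq> 0" "d \<noteq> 2 * M" using assms y by auto
  then consider "0 < d" "d < 2 * M" | "2 * M < d" using d by linarith
  then show ?thesis
  proof cases
    case 1
    then show ?thesis using edge_short y by simp
  next
    case 2
    \<comment> \<open>Going around the other way, the distance from \<open>v y\<close> to
      \<open>v x\<close> is \<open>4 * M - d\<close>, which is below \<open>2 * M\<close>.\<close>
    have "v x = v (x + d + (4 * M - d))" using v_periodic[of x 1] by simp
    then show ?thesis using edge_short[of "4 * M - d" "x + d"] 2 d y by (simp add: insert_commute)
  qed
qed

text \<open>A nonempty face fixed by the half turn would contain a vertex together with its
  antipode.\<close>

lemma central_symmetry_K: "central_symmetry K (rot (2 * M))"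
proof -
  have "rot (2 * M) (rot (2 * M) u) = u" if "u \<in> vertices K" for u
    using that v_periodic[of "int u" 1] by (simp add: rot_rot vertices_K v_of_nat algebra_simps)
  moreover have "rot (2 * M) ` s \<noteq> s" if s: "s \<in> K" "s \<noteq> {}" for s
  proof
    assume fixed: "rot (2 * M) ` s = s"
    obtain u where u: "u \<in> s" using s by blast
    then have "v (int u) = u" using s vertices_K by (auto simp: vertices_def intro!: v_of_nat)
    then have "{v (int u), v (int u + 2 * M)} \<subseteq> s"
      using u fixed by (auto simp: rot_def)
    then show False using no_antipodal_face s by blast
  qed
  ultimately show ?thesis
    by (simp add: central_symmetry_def simplicial_automorphism_def bij_rot rot_K)
qed

lemma nearly_neighborly_K: "nearly_neighborly_cs_3_sphere K"
proof -
  have "{u, w} \<in> K" if "u \<in> vertices K" "w \<in> vertices K" "u \<noteq> w" "w \<noteq> rot (2 * M) u" for u w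
    using edge[of "int u" "int w"] that by (simp add: vertices_K v_of_nat rot_def)
  then show ?thesis
    using central_symmetry_K K_sphere finite_complex_K
    by (auto simp: nearly_neighborly_cs_3_sphere_def simplicial_3_sphere_def centrally_2_neighborly_def)
qed

end

section \<open>The cyclic action\<close>

lemma cycle_of_list_upt:
  assumes "1 \<le> k" "k \<le> n"
  shows "cycle_of_list [1..<Suc n] k = (if k = n then 1 else Suc k)"
proof -
  let ?c = "cycle_of_list [1..<Suc n]"
  \<comment> \<open>Applying the cycle to its own list rotates the list by one; the entries at
    position \<open>k - 1\<close> give the value at \<open>k\<close>.\<close>
  have "map ?c [1..<Suc n] = rotate 1 [1..<Suc n]"
    using cyclic_rotation[of "[1..<Suc n]" 1] by simp
  then have "map ?c [1..<Suc n] ! (k - 1) = rotate 1 [1..<Suc n] ! (k - 1)" by simp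
  moreover have "k - 1 < length [1..<Suc n]" using assms by simp
  ultimately have "?c ([1..<Suc n] ! (k - 1)) = [1..<Suc n] ! ((1 + (k - 1)) mod n)"
    by (simp only: nth_map nth_rotate length_upt) (simp del: upt_Suc)
  then show ?thesis using assms by (auto simp del: upt_Suc simp: nth_upt)
qed

context cyclic_sphere
begin

text \<open>Labels start at 1, so vertices are labelled by \<open>Suc\<close>, which conjugates the
  rotation by 1 into the cycle \<open>?c\<close>.\<close>

lemma cyclic_action_K: "has_transitive_cyclic_action K"
proof -
  let ?n = "nat (4 * M)"
  let ?c = "cycle_of_list [1..<Suc ?n]"
  have card: "card (vertices K) = ?n" by (simp add: vertices_K)
  have "inj Suc" by simp
  have bij: "bij_betw Suc (vertices K) {1..?n}"
    by (simp add: bij_betw_def vertices_K image_Suc_lessThan)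
  have c: "?c (Suc u) = Suc (rot 1 u)" if "u \<in> vertices K" for u
  proof (cases "Suc u = ?n")
    case True
    then have "int u + 1 = 4 * M" by linarith
    then show ?thesis using True cycle_of_list_upt[of "Suc u" ?n] by (simp add: rot_def v_def)
  next
    case False
    then have "Suc u < ?n" using that by (simp add: vertices_K)
    then have "rot 1 u = Suc u" using v_of_nat[of "Suc u"] by (simp add: rot_def add.commute)
    then show ?thesis using False \<open>Suc u < ?n\<close> cycle_of_list_upt[of "Suc u" ?n] by simp
  qed
  have "(\<lambda>s. ?c ` s) ` (\<lambda>s. Suc ` s) ` K = (\<lambda>s. Suc ` s) ` (\<lambda>s. rot 1 ` s) ` K"
    unfolding image_image
  proof (rule image_cong[OF refl])
    fix s assume "s \<in> K"
    then have "s \<subseteq> vertices K" by (auto simp: vertices_def)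
    then show "(\<lambda>u. ?c (Suc u)) ` s = (\<lambda>u. Suc (rot 1 u)) ` s"
      using c by (intro image_cong) auto
  qed
  moreover have "vertices ((\<lambda>s. Suc ` s) ` K) = {1..?n}"
    using bij by (simp add: vertices_def bij_betw_def image_Union)
  moreover have "bij_betw ?c {1..?n} {1..?n}"
  proof -
    have "set [1..<Suc ?n] = {1..?n}" by auto
    then show ?thesis using cycle_permutes[of "[1..<Suc ?n]"] permutes_imp_bij by metis
  qed
  ultimately show ?thesis
    unfolding has_transitive_cyclic_action_def simplicial_automorphism_def card
    using bij by (intro exI[of _ Suc]) (simp only: rot_K simp_thms)
qed

end

theorem theorem6:
  fixes m :: nat
  assumes "m \<ge> 2"
  shows "\<exists>K :: nat set set.
           nearly_neighborly_cs_3_sphere K \<and> card (vertices K) = 4 * m \<and>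
           has_transitive_cyclic_action K"
proof -
  interpret cyclic_sphere "int m" by unfold_locales (use assms in simp)
  have "card (vertices K) = 4 * m" by (simp add: vertices_K nat_mult_distrib)
  then show ?thesis using nearly_neighborly_K cyclic_action_K by blast
qed

end
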